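(* Let $H$ be a Hopf $k$-algebra. For every partial representation $\pi: H\to B$ of $H$ on a unital $k$-algebra $B$ there is a unique algebra morphism $\hat\pi: H_{par}\to B$ such that $\pi=\hat\pi\circ[\underline{\ }]$. Conversely, given an algebra morphism $\phi: H_{par}\to B$, there exists a unique partial representation $\pi_\phi:H\to B$ such that $\phi=\widehat{\pi_\phi}$. In other words, the functors $$L:\mathsf{ParRep}_H\to H_{par}/\mathsf{Alg}_k,\quad L(B,\pi)=(B,\hat\pi),\qquad R: H_{par}/\mathsf{Alg}_k\to \mathsf{ParRep}_H,\quad R(B,\phi)=(B,\pi_\phi),$$ establish an isomorphism between the category of partial representations of $H$ and the co-slice category $H_{par}/\mathsf{Alg}_k$.
   Context: $k$ is a commutative ring; all algebras are associative unital $k$-algebras and algebra morphisms are unital. $H$ is a Hopf algebra over $k$ with comultiplication $\Delta(h)=h_{(1)}\otimes h_{(2)}$ (Sweedler notation) and antipode $S$. A partial representation of $H$ on a unital algebra $B$ is a $k$-linear map $\pi:H\to B$ such that for all $h,l\in H$: (PR1) $\pi(1_H)=1_B$; (PR2) $\pi(h)\pi(l_{(1)})\pi(S(l_{(2)}))=\pi(hl_{(1)})\pi(S(l_{(2)}))$; (PR3) $\pi(h_{(1)})\pi(S(h_{(2)}))\pi(l)=\pi(h_{(1)})\pi(S(h_{(2)})l)$; (PR4) $\pi(h)\pi(S(l_{(1)}))\pi(l_{(2)})=\pi(hS(l_{(1)}))\pi(l_{(2)})$; (PR5) $\pi(S(h_{(1)}))\pi(h_{(2)})\pi(l)=\pi(S(h_{(1)}))\pi(h_{(2)}l)$.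 The category $\mathsf{ParRep}_H$ has as objects pairs $(B,\pi)$ with $\pi$ a partial representation of $H$ on $B$; a morphism $(B,\pi)\to(B',\pi')$ is an algebra morphism $f:B\to B'$ with $\pi'=f\circ\pi$. $H_{par}$ is the quotient of the tensor algebra $T(H)$ by the ideal generated by the elements, for all $h,l\in H$: $1_H-1_{T(H)}$; $h\otimes l_{(1)}\otimes S(l_{(2)})-hl_{(1)}\otimes S(l_{(2)})$; $h_{(1)}\otimes S(h_{(2)})\otimes l-h_{(1)}\otimes S(h_{(2)})l$; $h\otimes S(l_{(1)})\otimes l_{(2)}-hS(l_{(1)})\otimes l_{(2)}$; $S(h_{(1)})\otimes h_{(2)}\otimes l-S(h_{(1)})\otimes h_{(2)}l$. The class of $h\in H$ is denoted $[h]$, and $[\underline{\ }]:H\to H_{par}$, $h\mapsto[h]$, is a partial representation. The co-slice category $H_{par}/\mathsf{Alg}_k$ has as objects pairs $(B,\phi)$ with $\phi:H_{par}\to B$ an algebra morphism; a morphism $(B,\phi)\to(B',\phi')$ is an algebra morphism $g:B\to B'$ with $g\circ\phi=\phi'$. Both functors are the identity on underlying algebra morphisms. *)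

theory Defs
  imports "HOL-Algebra.Module" "HOL-Algebra.QuotRing"
begin

text \<open>The locale \<^locale>\<open>algebra\<close> of the library is about commutative algebras only.\<close>

locale k_algebra = module k A + A: ring A
  for k (structure) and A (structure) +
  assumes smult_mult_left:
      "\<lbrakk>a \<in> carrier k; x \<in> carrier A; y \<in> carrier A\<rbrakk>
        \<Longrightarrow> (a \<odot>\<^bsub>A\<^esub> x) \<otimes>\<^bsub>A\<^esub> y = a \<odot>\<^bsub>A\<^esub> (x \<otimes>\<^bsub>A\<^esub> y)"
    and smult_mult_right:
      "\<lbrakk>a \<in> carrier k; x \<in> carrier A; y \<in> carrier A\<rbrakk>
        \<Longrightarrow> x \<otimes>\<^bsub>A\<^esub> (a \<odot>\<^bsub>A\<^esub> y) = a \<odot>\<^bsub>A\<^esub> (x \<otimes>\<^bsub>A\<^esub> y)"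

definition lin_map ::
  "('r, 'm) ring_scheme \<Rightarrow> ('r, 'a, 'u) module_scheme \<Rightarrow> ('r, 'b, 'v) module_scheme \<Rightarrow> ('a \<Rightarrow> 'b) set"
  where "lin_map k M N =
    {f \<in> carrier M \<rightarrow> carrier N.
      (\<forall>x\<in>carrier M. \<forall>y\<in>carrier M. f (x \<oplus>\<^bsub>M\<^esub> y) = f x \<oplus>\<^bsub>N\<^esub> f y) \<and>
      (\<forall>a\<in>carrier k. \<forall>x\<in>carrier M. f (a \<odot>\<^bsub>M\<^esub> x) = a \<odot>\<^bsub>N\<^esub> f x)}"

definition alg_hom ::
  "('r, 'm) ring_scheme \<Rightarrow> ('r, 'a, 'u) module_scheme \<Rightarrow> ('r, 'b, 'v) module_scheme \<Rightarrow> ('a \<Rightarrow> 'b) set"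
  where "alg_hom k A B = ring_hom A B \<inter> lin_map k A B"

text \<open>Algebra morphisms as set-theoretic functions on the carrier: two of them are equal as HOL
  functions iff they agree on the carrier.\<close>

definition alg_mor ::
  "('r, 'm) ring_scheme \<Rightarrow> ('r, 'a, 'u) module_scheme \<Rightarrow> ('r, 'b, 'v) module_scheme \<Rightarrow> ('a \<Rightarrow> 'b) set"
  where "alg_mor k A B = alg_hom k A B \<inter> extensional (carrier A)"

text \<open>The multiplicative fields of the \<^term>\<open>ring\<close> record play no role for a mere module.\<close>

definition free_module :: "('r, 'm) ring_scheme \<Rightarrow> 'x set \<Rightarrow> ('r, 'x \<Rightarrow> 'r) module"
  where "free_module k X =
    \<lparr>carrier = {p. range p \<subseteq> carrier k \<and> finite {x. p x \<noteq> \<zero>\<^bsub>k\<^esub>} \<and> {x. p x \<noteq> \<zero>\<^bsub>k\<^esub>} \<subseteq> X},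
     mult = undefined, one = undefined,
     zero = (\<lambda>_. \<zero>\<^bsub>k\<^esub>), add = (\<lambda>p q x. p x \<oplus>\<^bsub>k\<^esub> q x),
     smult = (\<lambda>a p x. a \<otimes>\<^bsub>k\<^esub> p x)\<rparr>"

definition basis :: "('r, 'm) ring_scheme \<Rightarrow> 'x \<Rightarrow> 'x \<Rightarrow> 'r"
  where "basis k x = (\<lambda>y. if y = x then \<one>\<^bsub>k\<^esub> else \<zero>\<^bsub>k\<^esub>)"

definition lin_ext ::
  "('r, 'm) ring_scheme \<Rightarrow> ('r, 'a, 'u) module_scheme \<Rightarrow> ('x \<Rightarrow> 'a) \<Rightarrow> ('x \<Rightarrow> 'r) \<Rightarrow> 'a"
  where "lin_ext k M f p = (\<Oplus>\<^bsub>M\<^esub>x\<in>{x. p x \<noteq> \<zero>\<^bsub>k\<^esub>}. p x \<odot>\<^bsub>M\<^esub> f x)"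

definition span_of ::
  "('r, 'm) ring_scheme \<Rightarrow> ('r, 'a, 'u) module_scheme \<Rightarrow> 'a set \<Rightarrow> 'a set"
  where "span_of k M S = \<Inter>{N. submodule N k M \<and> S \<subseteq> N}"

text \<open>The quotient of an algebra by an ideal or of a module by a submodule (in the latter case the
  multiplicative fields are meaningless): the quotient ring of the library together with the
  induced scalar multiplication.\<close>

definition quot_by :: "('r, 'a, 'u) module_scheme \<Rightarrow> 'a set \<Rightarrow> ('r, 'a set) module"
  where "quot_by A I =
    ring.extend (A Quot I) (module.fields (\<lambda>a X. \<Union>x\<in>X. I +>\<^bsub>A\<^esub> (a \<odot>\<^bsub>A\<^esub> x)))"

definition bilin_rels ::
  "('r, 'm) ring_scheme \<Rightarrow> ('r, 'a, 'u) module_scheme \<Rightarrow> ('r, 'b, 'v) module_scheme \<Rightarrow> ('a \<times> 'b \<Rightarrow> 'r) set"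
  where "bilin_rels k M N =
    (let F = free_module k (carrier M \<times> carrier N); e = basis k in
      {e (x \<oplus>\<^bsub>M\<^esub> x', y) \<ominus>\<^bsub>F\<^esub> (e (x, y) \<oplus>\<^bsub>F\<^esub> e (x', y)) | x x' y.
        x \<in> carrier M \<and> x' \<in> carrier M \<and> y \<in> carrier N} \<union>
      {e (x, y \<oplus>\<^bsub>N\<^esub> y') \<ominus>\<^bsub>F\<^esub> (e (x, y) \<oplus>\<^bsub>F\<^esub> e (x, y')) | x y y'.
        x \<in> carrier M \<and> y \<in> carrier N \<and> y' \<in> carrier N} \<union>
      {e (a \<odot>\<^bsub>M\<^esub> x, y) \<ominus>\<^bsub>F\<^esub> a \<odot>\<^bsub>F\<^esub> e (x, y) | a x y.
        a \<in> carrier k \<and> x \<in> carrier M \<and> y \<in> carrier N} \<union>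
      {e (x, a \<odot>\<^bsub>N\<^esub> y) \<ominus>\<^bsub>F\<^esub> a \<odot>\<^bsub>F\<^esub> e (x, y) | a x y.
        a \<in> carrier k \<and> x \<in> carrier M \<and> y \<in> carrier N})"

definition tensor_sub ::
  "('r, 'm) ring_scheme \<Rightarrow> ('r, 'a, 'u) module_scheme \<Rightarrow> ('r, 'b, 'v) module_scheme \<Rightarrow> ('a \<times> 'b \<Rightarrow> 'r) set"
  where "tensor_sub k M N =
    span_of k (free_module k (carrier M \<times> carrier N)) (bilin_rels k M N)"

definition tensor_mod ::
  "('r, 'm) ring_scheme \<Rightarrow> ('r, 'a, 'u) module_scheme \<Rightarrow> ('r, 'b, 'v) module_scheme
    \<Rightarrow> ('r, ('a \<times> 'b \<Rightarrow> 'r) set) module"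
  where "tensor_mod k M N =
    quot_by (free_module k (carrier M \<times> carrier N)) (tensor_sub k M N)"

definition pure_tensor ::
  "('r, 'm) ring_scheme \<Rightarrow> ('r, 'a, 'u) module_scheme \<Rightarrow> ('r, 'b, 'v) module_scheme
    \<Rightarrow> 'a \<Rightarrow> 'b \<Rightarrow> ('a \<times> 'b \<Rightarrow> 'r) set"
  where "pure_tensor k M N x y =
    tensor_sub k M N +>\<^bsub>free_module k (carrier M \<times> carrier N)\<^esub> basis k (x, y)"

text \<open>The linear map into \<open>P\<close> induced by a bilinear map \<open>f\<close>, evaluated at the tensor \<open>t\<close>.  The
  chosen representative of the coset \<open>t\<close> is what Sweedler's notation writes as a sum of
  \<open>t\<^sub>1 \<otimes> t\<^sub>2\<close>; for bilinear \<open>f\<close> the value does not depend on the choice.\<close>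

definition tensor_lift ::
  "('r, 'm) ring_scheme \<Rightarrow> ('r, 'c, 'u) module_scheme \<Rightarrow> ('a \<Rightarrow> 'b \<Rightarrow> 'c) \<Rightarrow> ('a \<times> 'b \<Rightarrow> 'r) set \<Rightarrow> 'c"
  where "tensor_lift k P f t = lin_ext k P (\<lambda>(x, y). f x y) (SOME p. p \<in> t)"

definition tensor_map ::
  "('r, 'm) ring_scheme \<Rightarrow> ('r, 'c, 'u) module_scheme \<Rightarrow> ('r, 'd, 'v) module_scheme
    \<Rightarrow> ('a \<Rightarrow> 'c) \<Rightarrow> ('b \<Rightarrow> 'd) \<Rightarrow> ('a \<times> 'b \<Rightarrow> 'r) set \<Rightarrow> ('c \<times> 'd \<Rightarrow> 'r) set"
  where "tensor_map k P Q f g =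
    tensor_lift k (tensor_mod k P Q) (\<lambda>x y. pure_tensor k P Q (f x) (g y))"

text \<open>The isomorphism from \<open>(L \<otimes> M) \<otimes> N\<close> to \<open>L \<otimes> (M \<otimes> N)\<close>.\<close>

definition tensor_assoc ::
  "('r, 'm) ring_scheme \<Rightarrow> ('r, 'a, 'u) module_scheme \<Rightarrow> ('r, 'b, 'v) module_scheme
    \<Rightarrow> ('r, 'c, 'w) module_scheme \<Rightarrow> (('a \<times> 'b \<Rightarrow> 'r) set \<times> 'c \<Rightarrow> 'r) set
    \<Rightarrow> ('a \<times> ('b \<times> 'c \<Rightarrow> 'r) set \<Rightarrow> 'r) set"
  where "tensor_assoc k L M N =
    (let T = tensor_mod k L (tensor_mod k M N) in
      tensor_lift k T (\<lambda>t z.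
        tensor_lift k T (\<lambda>x y.
          pure_tensor k L (tensor_mod k M N) x (pure_tensor k M N y z)) t))"

definition tensor_alg ::
  "('r, 'm) ring_scheme \<Rightarrow> ('r, 'a, 'u) module_scheme \<Rightarrow> ('r, 'b, 'v) module_scheme
    \<Rightarrow> ('r, ('a \<times> 'b \<Rightarrow> 'r) set) module"
  where "tensor_alg k A B =
    (let T = tensor_mod k A B in
      T\<lparr>mult := (\<lambda>s t.
          tensor_lift k T (\<lambda>x y.
            tensor_lift k T (\<lambda>x' y'.
              pure_tensor k A B (x \<otimes>\<^bsub>A\<^esub> x') (y \<otimes>\<^bsub>B\<^esub> y')) t) s),
        one := pure_tensor k A B \<one>\<^bsub>A\<^esub> \<one>\<^bsub>B\<^esub>\<rparr>)"

record ('r, 'h) hopf = "('r, 'h) module" +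
  comult :: "'h \<Rightarrow> ('h \<times> 'h \<Rightarrow> 'r) set"
  counit :: "'h \<Rightarrow> 'r"
  antipode :: "'h \<Rightarrow> 'h"

text \<open>\<open>sweedler k H M f h\<close> is the Sweedler sum of all \<open>f h\<^sub>(\<^sub>1\<^sub>) h\<^sub>(\<^sub>2\<^sub>)\<close>, taken in \<open>M\<close>.\<close>

definition sweedler ::
  "('r, 'm) ring_scheme \<Rightarrow> ('r, 'h, 'u) hopf_scheme \<Rightarrow> ('r, 'a, 'v) module_scheme
    \<Rightarrow> ('h \<Rightarrow> 'h \<Rightarrow> 'a) \<Rightarrow> 'h \<Rightarrow> 'a"
  where "sweedler k H M f h = tensor_lift k M f (comult H h)"

locale hopf_algebra = k_algebra k H
  for k (structure) and H (structure) +
  assumes comult_hom: "comult H \<in> alg_hom k H (tensor_alg k H H)"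
    and counit_hom: "counit H \<in> ring_hom H k"
    and counit_smult:
      "\<lbrakk>a \<in> carrier k; h \<in> carrier H\<rbrakk> \<Longrightarrow> counit H (a \<odot>\<^bsub>H\<^esub> h) = a \<otimes>\<^bsub>k\<^esub> counit H h"
    and antipode_lin: "antipode H \<in> lin_map k H H"
    and coassoc: "h \<in> carrier H \<Longrightarrow>
      tensor_assoc k H H H
        (tensor_map k (tensor_mod k H H) H (comult H) (\<lambda>x. x) (comult H h)) =
      tensor_map k H (tensor_mod k H H) (\<lambda>x. x) (comult H) (comult H h)"
    and counit_left: "h \<in> carrier H \<Longrightarrow>
      sweedler k H H (\<lambda>h1 h2. counit H h1 \<odot>\<^bsub>H\<^esub> h2) h = h"
    and counit_right: "h \<in> carrier H \<Longrightarrow>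
      sweedler k H H (\<lambda>h1 h2. counit H h2 \<odot>\<^bsub>H\<^esub> h1) h = h"
    and antipode_left: "h \<in> carrier H \<Longrightarrow>
      sweedler k H H (\<lambda>h1 h2. antipode H h1 \<otimes>\<^bsub>H\<^esub> h2) h = counit H h \<odot>\<^bsub>H\<^esub> \<one>\<^bsub>H\<^esub>"
    and antipode_right: "h \<in> carrier H \<Longrightarrow>
      sweedler k H H (\<lambda>h1 h2. h1 \<otimes>\<^bsub>H\<^esub> antipode H h2) h = counit H h \<odot>\<^bsub>H\<^esub> \<one>\<^bsub>H\<^esub>"

definition par_rep ::
  "('r, 'm) ring_scheme \<Rightarrow> ('r, 'h, 'u) hopf_scheme \<Rightarrow> ('r, 'b, 'v) module_scheme
    \<Rightarrow> ('h \<Rightarrow> 'b) \<Rightarrow> bool"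
  where "par_rep k H B \<pi> \<longleftrightarrow>
    (let S = antipode H in
     \<pi> \<in> lin_map k H B \<and> \<pi> \<in> extensional (carrier H) \<and>
     \<pi> \<one>\<^bsub>H\<^esub> = \<one>\<^bsub>B\<^esub> \<and>
     (\<forall>h\<in>carrier H. \<forall>l\<in>carrier H.
        sweedler k H B (\<lambda>l1 l2. \<pi> h \<otimes>\<^bsub>B\<^esub> \<pi> l1 \<otimes>\<^bsub>B\<^esub> \<pi> (S l2)) l =
        sweedler k H B (\<lambda>l1 l2. \<pi> (h \<otimes>\<^bsub>H\<^esub> l1) \<otimes>\<^bsub>B\<^esub> \<pi> (S l2)) l) \<and>
     (\<forall>h\<in>carrier H. \<forall>l\<in>carrier H.
        sweedler k H B (\<lambda>h1 h2. \<pi> h1 \<otimes>\<^bsub>B\<^esub> \<pi> (S h2) \<otimes>\<^bsub>B\<^esub> \<pi> l) h =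
        sweedler k H B (\<lambda>h1 h2. \<pi> h1 \<otimes>\<^bsub>B\<^esub> \<pi> (S h2 \<otimes>\<^bsub>H\<^esub> l)) h) \<and>
     (\<forall>h\<in>carrier H. \<forall>l\<in>carrier H.
        sweedler k H B (\<lambda>l1 l2. \<pi> h \<otimes>\<^bsub>B\<^esub> \<pi> (S l1) \<otimes>\<^bsub>B\<^esub> \<pi> l2) l =
        sweedler k H B (\<lambda>l1 l2. \<pi> (h \<otimes>\<^bsub>H\<^esub> S l1) \<otimes>\<^bsub>B\<^esub> \<pi> l2) l) \<and>
     (\<forall>h\<in>carrier H. \<forall>l\<in>carrier H.
        sweedler k H B (\<lambda>h1 h2. \<pi> (S h1) \<otimes>\<^bsub>B\<^esub> \<pi> h2 \<otimes>\<^bsub>B\<^esub> \<pi> l) h =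
        sweedler k H B (\<lambda>h1 h2. \<pi> (S h1) \<otimes>\<^bsub>B\<^esub> \<pi> (h2 \<otimes>\<^bsub>H\<^esub> l)) h))"

definition free_alg :: "('r, 'm) ring_scheme \<Rightarrow> 'x set \<Rightarrow> ('r, 'x list \<Rightarrow> 'r) module"
  where "free_alg k X = (free_module k (lists X))
    \<lparr>mult := (\<lambda>p q w. \<Oplus>\<^bsub>k\<^esub>i\<in>{..length w}. p (take i w) \<otimes>\<^bsub>k\<^esub> q (drop i w)),
     one := basis k []\<rparr>"

definition multilin_rels ::
  "('r, 'm) ring_scheme \<Rightarrow> ('r, 'a, 'u) module_scheme \<Rightarrow> ('a list \<Rightarrow> 'r) set"
  where "multilin_rels k M =
    (let F = free_alg k (carrier M); e = basis k in
      {e (u @ [x \<oplus>\<^bsub>M\<^esub> y] @ v) \<ominus>\<^bsub>F\<^esub> (e (u @ [x] @ v) \<oplus>\<^bsub>F\<^esub> e (u @ [y] @ v)) | u v x y.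
        u \<in> lists (carrier M) \<and> v \<in> lists (carrier M) \<and> x \<in> carrier M \<and> y \<in> carrier M} \<union>
      {e (u @ [a \<odot>\<^bsub>M\<^esub> x] @ v) \<ominus>\<^bsub>F\<^esub> a \<odot>\<^bsub>F\<^esub> e (u @ [x] @ v) | a u v x.
        a \<in> carrier k \<and> u \<in> lists (carrier M) \<and> v \<in> lists (carrier M) \<and> x \<in> carrier M})"

definition multilin_sub ::
  "('r, 'm) ring_scheme \<Rightarrow> ('r, 'a, 'u) module_scheme \<Rightarrow> ('a list \<Rightarrow> 'r) set"
  where "multilin_sub k M = span_of k (free_alg k (carrier M)) (multilin_rels k M)"

text \<open>The words of length \<open>n\<close>, modulo multilinearity in their letters, span the \<open>n\<close>-th tensor
  power of \<open>M\<close>; all words together give the direct sum of the tensor powers, multiplied by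
  concatenation.\<close>

definition tensor_algebra ::
  "('r, 'm) ring_scheme \<Rightarrow> ('r, 'a, 'u) module_scheme \<Rightarrow> ('r, ('a list \<Rightarrow> 'r) set) module"
  where "tensor_algebra k M = quot_by (free_alg k (carrier M)) (multilin_sub k M)"

definition tensor_gen ::
  "('r, 'm) ring_scheme \<Rightarrow> ('r, 'a, 'u) module_scheme \<Rightarrow> 'a \<Rightarrow> ('a list \<Rightarrow> 'r) set"
  where "tensor_gen k M x = multilin_sub k M +>\<^bsub>free_alg k (carrier M)\<^esub> basis k [x]"

definition Hpar_rels ::
  "('r, 'm) ring_scheme \<Rightarrow> ('r, 'h, 'u) hopf_scheme \<Rightarrow> ('h list \<Rightarrow> 'r) set set"
  where "Hpar_rels k H =
    (let T = tensor_algebra k H; g = tensor_gen k H; S = antipode H in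
      {g \<one>\<^bsub>H\<^esub> \<ominus>\<^bsub>T\<^esub> \<one>\<^bsub>T\<^esub>} \<union>
      {sweedler k H T (\<lambda>l1 l2. g h \<otimes>\<^bsub>T\<^esub> g l1 \<otimes>\<^bsub>T\<^esub> g (S l2)) l \<ominus>\<^bsub>T\<^esub>
       sweedler k H T (\<lambda>l1 l2. g (h \<otimes>\<^bsub>H\<^esub> l1) \<otimes>\<^bsub>T\<^esub> g (S l2)) l | h l.
        h \<in> carrier H \<and> l \<in> carrier H} \<union>
      {sweedler k H T (\<lambda>h1 h2. g h1 \<otimes>\<^bsub>T\<^esub> g (S h2) \<otimes>\<^bsub>T\<^esub> g l) h \<ominus>\<^bsub>T\<^esub>
       sweedler k H T (\<lambda>h1 h2. g h1 \<otimes>\<^bsub>T\<^esub> g (S h2 \<otimes>\<^bsub>H\<^esub> l)) h | h l.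
        h \<in> carrier H \<and> l \<in> carrier H} \<union>
      {sweedler k H T (\<lambda>l1 l2. g h \<otimes>\<^bsub>T\<^esub> g (S l1) \<otimes>\<^bsub>T\<^esub> g l2) l \<ominus>\<^bsub>T\<^esub>
       sweedler k H T (\<lambda>l1 l2. g (h \<otimes>\<^bsub>H\<^esub> S l1) \<otimes>\<^bsub>T\<^esub> g l2) l | h l.
        h \<in> carrier H \<and> l \<in> carrier H} \<union>
      {sweedler k H T (\<lambda>h1 h2. g (S h1) \<otimes>\<^bsub>T\<^esub> g h2 \<otimes>\<^bsub>T\<^esub> g l) h \<ominus>\<^bsub>T\<^esub>
       sweedler k H T (\<lambda>h1 h2. g (S h1) \<otimes>\<^bsub>T\<^esub> g (h2 \<otimes>\<^bsub>H\<^esub> l)) h | h l.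
        h \<in> carrier H \<and> l \<in> carrier H})"

definition Hpar_ideal ::
  "('r, 'm) ring_scheme \<Rightarrow> ('r, 'h, 'u) hopf_scheme \<Rightarrow> ('h list \<Rightarrow> 'r) set set"
  where "Hpar_ideal k H = Idl\<^bsub>tensor_algebra k H\<^esub> (Hpar_rels k H)"

definition Hpar ::
  "('r, 'm) ring_scheme \<Rightarrow> ('r, 'h, 'u) hopf_scheme \<Rightarrow> ('r, ('h list \<Rightarrow> 'r) set set) module"
  where "Hpar k H = quot_by (tensor_algebra k H) (Hpar_ideal k H)"

definition Hpar_class ::
  "('r, 'm) ring_scheme \<Rightarrow> ('r, 'h, 'u) hopf_scheme \<Rightarrow> 'h \<Rightarrow> ('h list \<Rightarrow> 'r) set set"
  where "Hpar_class k H =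
    (\<lambda>h\<in>carrier H. Hpar_ideal k H +>\<^bsub>tensor_algebra k H\<^esub> tensor_gen k H h)"

definition par_rep_hat ::
  "('r, 'm) ring_scheme \<Rightarrow> ('r, 'h, 'u) hopf_scheme \<Rightarrow> ('r, 'b, 'v) module_scheme
    \<Rightarrow> ('h \<Rightarrow> 'b) \<Rightarrow> ('h list \<Rightarrow> 'r) set set \<Rightarrow> 'b"
  where "par_rep_hat k H B \<pi> =
    (THE f. f \<in> alg_mor k (Hpar k H) B \<and> \<pi> = compose (carrier H) f (Hpar_class k H))"

definition par_rep_of ::
  "('r, 'm) ring_scheme \<Rightarrow> ('r, 'h, 'u) hopf_scheme \<Rightarrow> ('r, 'b, 'v) module_scheme
    \<Rightarrow> (('h list \<Rightarrow> 'r) set set \<Rightarrow> 'b) \<Rightarrow> 'h \<Rightarrow> 'b"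
  where "par_rep_of k H B \<phi> =
    (THE \<pi>. par_rep k H B \<pi> \<and> \<phi> = par_rep_hat k H B \<pi>)"

text \<open>Composition and functors on morphisms carry the objects as arguments because a morphism
  set is given only relative to its source and target.\<close>

record ('o, 'f) cat =
  Obj :: "'o set"
  Hom :: "'o \<Rightarrow> 'o \<Rightarrow> 'f set"
  Ident :: "'o \<Rightarrow> 'f"
  Comp :: "'o \<Rightarrow> 'o \<Rightarrow> 'o \<Rightarrow> 'f \<Rightarrow> 'f \<Rightarrow> 'f"

definition is_category :: "('o, 'f) cat \<Rightarrow> bool"
  where "is_category C \<longleftrightarrow>
    (\<forall>X\<in>Obj C. Ident C X \<in> Hom C X X) \<and>
    (\<forall>X\<in>Obj C. \<forall>Y\<in>Obj C. \<forall>Z\<in>Obj C. \<forall>f\<in>Hom C X Y. \<forall>g\<in>Hom C Y Z.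
      Comp C X Y Z g f \<in> Hom C X Z) \<and>
    (\<forall>X\<in>Obj C. \<forall>Y\<in>Obj C. \<forall>f\<in>Hom C X Y.
      Comp C X X Y f (Ident C X) = f \<and> Comp C X Y Y (Ident C Y) f = f) \<and>
    (\<forall>W\<in>Obj C. \<forall>X\<in>Obj C. \<forall>Y\<in>Obj C. \<forall>Z\<in>Obj C.
      \<forall>f\<in>Hom C W X. \<forall>g\<in>Hom C X Y. \<forall>h\<in>Hom C Y Z.
        Comp C W Y Z h (Comp C W X Y g f) = Comp C W X Z (Comp C X Y Z h g) f)"

record ('o, 'f, 'p, 'g) cat_functor =
  on_obj :: "'o \<Rightarrow> 'p"
  on_mor :: "'o \<Rightarrow> 'o \<Rightarrow> 'f \<Rightarrow> 'g"

definition is_functor :: "('o, 'f) cat \<Rightarrow> ('p, 'g) cat \<Rightarrow> ('o, 'f, 'p, 'g) cat_functor \<Rightarrow> bool"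
  where "is_functor C D F \<longleftrightarrow>
    is_category C \<and> is_category D \<and>
    (\<forall>X\<in>Obj C. on_obj F X \<in> Obj D) \<and>
    (\<forall>X\<in>Obj C. \<forall>Y\<in>Obj C. \<forall>f\<in>Hom C X Y.
      on_mor F X Y f \<in> Hom D (on_obj F X) (on_obj F Y)) \<and>
    (\<forall>X\<in>Obj C. on_mor F X X (Ident C X) = Ident D (on_obj F X)) \<and>
    (\<forall>X\<in>Obj C. \<forall>Y\<in>Obj C. \<forall>Z\<in>Obj C. \<forall>f\<in>Hom C X Y. \<forall>g\<in>Hom C Y Z.
      on_mor F X Z (Comp C X Y Z g f) =
        Comp D (on_obj F X) (on_obj F Y) (on_obj F Z) (on_mor F Y Z g) (on_mor F X Y f))"

definition left_inverse_functor ::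
  "('o, 'f) cat \<Rightarrow> ('o, 'f, 'p, 'g) cat_functor \<Rightarrow> ('p, 'g, 'o, 'f) cat_functor \<Rightarrow> bool"
  where "left_inverse_functor C F G \<longleftrightarrow>
    (\<forall>X\<in>Obj C. on_obj G (on_obj F X) = X) \<and>
    (\<forall>X\<in>Obj C. \<forall>Y\<in>Obj C. \<forall>f\<in>Hom C X Y.
      on_mor G (on_obj F X) (on_obj F Y) (on_mor F X Y f) = f)"

definition isomorphism_of_categories ::
  "('o, 'f) cat \<Rightarrow> ('p, 'g) cat \<Rightarrow> ('o, 'f, 'p, 'g) cat_functor \<Rightarrow> ('p, 'g, 'o, 'f) cat_functor \<Rightarrow> bool"
  where "isomorphism_of_categories C D F G \<longleftrightarrow>
    is_functor C D F \<and> is_functor D C G \<and>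
    left_inverse_functor C F G \<and> left_inverse_functor D G F"

text \<open>Both categories below consist of the algebras with carrier in the type \<open>'b\<close>.\<close>

definition ParRep ::
  "('r, 'm) ring_scheme \<Rightarrow> ('r, 'h, 'u) hopf_scheme
    \<Rightarrow> (('r, 'b) module \<times> ('h \<Rightarrow> 'b), 'b \<Rightarrow> 'b) cat"
  where "ParRep k H =
    \<lparr>Obj = {(B, \<pi>). k_algebra k B \<and> par_rep k H B \<pi>},
     Hom = (\<lambda>(B, \<pi>) (B', \<pi>'). {f \<in> alg_mor k B B'. \<pi>' = compose (carrier H) f \<pi>}),
     Ident = (\<lambda>(B, \<pi>). \<lambda>x\<in>carrier B. x),
     Comp = (\<lambda>(B, \<pi>) Y Z g f. compose (carrier B) g f)\<rparr>"

definition Coslice ::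
  "('r, 'm) ring_scheme \<Rightarrow> ('r, 'a, 'u) module_scheme
    \<Rightarrow> (('r, 'b) module \<times> ('a \<Rightarrow> 'b), 'b \<Rightarrow> 'b) cat"
  where "Coslice k A =
    \<lparr>Obj = {(B, \<phi>). k_algebra k B \<and> \<phi> \<in> alg_mor k A B},
     Hom = (\<lambda>(B, \<phi>) (B', \<phi>'). {g \<in> alg_mor k B B'. compose (carrier A) g \<phi> = \<phi>'}),
     Ident = (\<lambda>(B, \<phi>). \<lambda>x\<in>carrier B. x),
     Comp = (\<lambda>(B, \<phi>) Y Z g f. compose (carrier B) g f)\<rparr>"

definition L_functor ::
  "('r, 'm) ring_scheme \<Rightarrow> ('r, 'h, 'u) hopf_scheme
    \<Rightarrow> (('r, 'b) module \<times> ('h \<Rightarrow> 'b), 'b \<Rightarrow> 'b,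
        ('r, 'b) module \<times> (('h list \<Rightarrow> 'r) set set \<Rightarrow> 'b), 'b \<Rightarrow> 'b) cat_functor"
  where "L_functor k H =
    \<lparr>on_obj = (\<lambda>(B, \<pi>). (B, par_rep_hat k H B \<pi>)), on_mor = (\<lambda>X Y f. f)\<rparr>"

definition R_functor ::
  "('r, 'm) ring_scheme \<Rightarrow> ('r, 'h, 'u) hopf_scheme
    \<Rightarrow> (('r, 'b) module \<times> (('h list \<Rightarrow> 'r) set set \<Rightarrow> 'b), 'b \<Rightarrow> 'b,
        ('r, 'b) module \<times> ('h \<Rightarrow> 'b), 'b \<Rightarrow> 'b) cat_functor"
  where "R_functor k H =
    \<lparr>on_obj = (\<lambda>(B, \<phi>). (B, par_rep_of k H B \<phi>)), on_mor = (\<lambda>X Y f. f)\<rparr>"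

end

theory Submission
  imports Defs
begin

text \<open>
  Both sides of the correspondence are linear maps out of \<open>H\<close> in disguise.  A linear map
  \<open>\<pi> : H \<rightarrow> B\<close> extends uniquely to an algebra morphism \<open>\<tau>\<close> from the tensor algebra to \<open>B\<close>
  (\<open>tensor_algebra_lift\<close>, \<open>tensor_algebra_hom_eqI\<close>), and \<open>\<tau>\<close> factors through \<open>H\<^sub>p\<^sub>a\<^sub>r\<close> exactly when
  it kills the generating relations.  These relations are the differences of the two sides of the
  axioms of a partial representation, formed for the inclusion of \<open>H\<close> into its tensor algebra.  Hence
  everything rests on one naturality statement, \<open>par_rep_eqs_natural\<close>: applying an algebra morphism to
  a side of an axiom gives the same side for the composed map.  It yields that \<open>\<tau>\<close> kills the relations
  if and only if \<open>\<pi>\<close> is a partial representation (\<open>kills_rels_iff\<close>), and that partial representations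
  may be composed with algebra morphisms (\<open>par_rep_comp\<close>).

  Naturality in turn comes down to Sweedler sums commuting with linear maps (\<open>sweedler_natural\<close>).  A
  Sweedler sum is evaluated on a chosen representative of \<open>\<Delta>(h)\<close>, a finite formal combination of
  pairs which is the same for every target module; so the commutation holds summand by summand.

  The correspondence \<open>\<phi> \<mapsto> \<phi> \<circ> [_]\<close> from morphisms out of \<open>H\<^sub>p\<^sub>a\<^sub>r\<close> to partial representations is
  therefore bijective, the inverse being the lift just described.  It commutes with composition by an
  algebra morphism \<open>B \<rightarrow> B'\<close>, so the morphisms of the two categories are the same algebra
  morphisms and the two functors are inverse to each other.

  Throughout, identities between expressions that are linear in an argument are verified on basis
  elements, which for the free algebra are words.
\<close>

section \<open>Linear maps and generated submodules\<close>

lemma lin_mapI: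
  assumes "\<And>x. x \<in> carrier M \<Longrightarrow> f x \<in> carrier N"
    and "\<And>x y. \<lbrakk>x \<in> carrier M; y \<in> carrier M\<rbrakk> \<Longrightarrow> f (x \<oplus>\<^bsub>M\<^esub> y) = f x \<oplus>\<^bsub>N\<^esub> f y"
    and "\<And>a x. \<lbrakk>a \<in> carrier k; x \<in> carrier M\<rbrakk> \<Longrightarrow> f (a \<odot>\<^bsub>M\<^esub> x) = a \<odot>\<^bsub>N\<^esub> f x"
  shows "f \<in> lin_map k M N"
  using assms unfolding lin_map_def by auto

lemma lin_map_closed: "\<lbrakk>f \<in> lin_map k M N; x \<in> carrier M\<rbrakk> \<Longrightarrow> f x \<in> carrier N"
  and lin_map_add: "\<lbrakk>f \<in> lin_map k M N; x \<in> carrier M; y \<in> carrier M\<rbrakk>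
    \<Longrightarrow> f (x \<oplus>\<^bsub>M\<^esub> y) = f x \<oplus>\<^bsub>N\<^esub> f y"
  and lin_map_smult: "\<lbrakk>f \<in> lin_map k M N; a \<in> carrier k; x \<in> carrier M\<rbrakk>
    \<Longrightarrow> f (a \<odot>\<^bsub>M\<^esub> x) = a \<odot>\<^bsub>N\<^esub> f x"
  unfolding lin_map_def by auto

lemma lin_map_comp: "\<lbrakk>f \<in> lin_map k L M; g \<in> lin_map k M N\<rbrakk> \<Longrightarrow> (\<lambda>x. g (f x)) \<in> lin_map k L N"
  unfolding lin_map_def by (auto simp: Pi_iff)

context
  fixes k M N f
  assumes M: "module k M" and N: "module k N" and f: "f \<in> lin_map k M N"
begin

interpretation M: module k M by (fact M)
interpretation N: module k N by (fact N)

lemma lin_map_zero: "f \<zero>\<^bsub>M\<^esub> = \<zero>\<^bsub>N\<^esub>"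
proof -
  have "f \<zero>\<^bsub>M\<^esub> = f (\<zero>\<^bsub>k\<^esub> \<odot>\<^bsub>M\<^esub> \<zero>\<^bsub>M\<^esub>)" by simp
  also have "\<dots> = \<zero>\<^bsub>k\<^esub> \<odot>\<^bsub>N\<^esub> f \<zero>\<^bsub>M\<^esub>" by (rule lin_map_smult[OF f]) auto
  also have "\<dots> = \<zero>\<^bsub>N\<^esub>" by (simp add: lin_map_closed[OF f])
  finally show ?thesis .
qed

lemma lin_map_uminus:
  assumes "x \<in> carrier M"
  shows "f (\<ominus>\<^bsub>M\<^esub> x) = \<ominus>\<^bsub>N\<^esub> f x"
proof -
  have "f (\<ominus>\<^bsub>M\<^esub> x) = f ((\<ominus>\<^bsub>k\<^esub> \<one>\<^bsub>k\<^esub>) \<odot>\<^bsub>M\<^esub> x)" using assms by (simp add: M.smult_l_minus)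
  also have "\<dots> = (\<ominus>\<^bsub>k\<^esub> \<one>\<^bsub>k\<^esub>) \<odot>\<^bsub>N\<^esub> f x" using assms by (intro lin_map_smult[OF f]) auto
  also have "\<dots> = \<ominus>\<^bsub>N\<^esub> f x" using assms by (simp add: N.smult_l_minus lin_map_closed[OF f])
  finally show ?thesis .
qed

lemma lin_map_minus:
  "\<lbrakk>x \<in> carrier M; y \<in> carrier M\<rbrakk> \<Longrightarrow> f (x \<ominus>\<^bsub>M\<^esub> y) = f x \<ominus>\<^bsub>N\<^esub> f y"
  by (simp add: a_minus_def lin_map_add[OF f] lin_map_uminus)

lemma submodule_preimage:
  assumes "submodule K k N"
  shows "submodule {x \<in> carrier M. f x \<in> K} k M"
  using N.submoduleE[OF assms] subgroup.one_closed[OF submodule.axioms(1)[OF assms]]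
  by (intro M.submoduleI)
     (auto simp: lin_map_zero lin_map_uminus lin_map_add[OF f] lin_map_smult[OF f])

end

lemma (in module) submodule_zero: "submodule {\<zero>\<^bsub>M\<^esub>} R M"
  by (rule submoduleI) auto

lemma span_of_base: "S \<subseteq> span_of k M S"
  unfolding span_of_def by blast

lemma span_of_least: "\<lbrakk>submodule K k M; S \<subseteq> K\<rbrakk> \<Longrightarrow> span_of k M S \<subseteq> K"
  unfolding span_of_def by blast

lemma (in module) span_of_submodule:
  assumes "S \<subseteq> carrier M"
  shows "submodule (span_of R M S) R M"
proof (rule submoduleI)
  show "span_of R M S \<subseteq> carrier M"
    by (rule span_of_least[OF carrier_is_submodule assms])
  show "\<zero>\<^bsub>M\<^esub> \<in> span_of R M S"
    unfolding span_of_def using subgroup.one_closed[OF submodule.axioms(1)] by fastforce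
qed (auto simp: span_of_def submoduleE)

text \<open>A linear map sends a generated submodule into \<open>K\<close> as soon as it sends the generators there,
  because preimages of submodules are submodules.  With \<open>K = 0\<close> this lets maps descend to
  quotients; with \<open>K\<close> the generated submodule itself it shows stability under operators.\<close>

lemma lin_map_span_subset:
  assumes "module k M" "module k N" "f \<in> lin_map k M N"
    and "S \<subseteq> carrier M" "submodule K k N" "f ` S \<subseteq> K"
  shows "f ` span_of k M S \<subseteq> K"
  using span_of_least[OF submodule_preimage[OF assms(1-3,5)], of S] assms(4,6) by auto

section \<open>Free modules\<close>

lemma free_module_simps:
  "carrier (free_module k X) =
    {p. range p \<subseteq> carrier k \<and> finite {x. p x \<noteq> \<zero>\<^bsub>k\<^esub>} \<and> {x. p x \<noteq> \<zero>\<^bsub>k\<^esub>} \<subseteq> X}"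
  "zero (free_module k X) = (\<lambda>_. \<zero>\<^bsub>k\<^esub>)"
  "add (free_module k X) = (\<lambda>p q x. p x \<oplus>\<^bsub>k\<^esub> q x)"
  "smult (free_module k X) = (\<lambda>a p x. a \<otimes>\<^bsub>k\<^esub> p x)"
  by (simp_all add: free_module_def)

context cring
begin

lemma free_module_carrierI:
  assumes "\<And>x. p x \<in> carrier R" "finite A" "A \<subseteq> X" "\<And>x. x \<notin> A \<Longrightarrow> p x = \<zero>"
  shows "p \<in> carrier (free_module R X)"
proof -
  have "{x. p x \<noteq> \<zero>} \<subseteq> A" using assms(4) by auto
  thus ?thesis using assms by (auto simp: free_module_simps intro: finite_subset)
qed

lemma free_module_coeff: "p \<in> carrier (free_module R X) \<Longrightarrow> p x \<in> carrier R"
  by (auto simp: free_module_simps)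

lemma free_module_add_closed:
  assumes "p \<in> carrier (free_module R X)" "q \<in> carrier (free_module R X)"
  shows "(\<lambda>x. p x \<oplus> q x) \<in> carrier (free_module R X)"
  using assms
  by (intro free_module_carrierI[where A = "{x. p x \<noteq> \<zero>} \<union> {x. q x \<noteq> \<zero>}"])
     (auto simp: free_module_coeff, auto simp: free_module_simps)

lemma free_module_smult_closed:
  assumes "a \<in> carrier R" "p \<in> carrier (free_module R X)"
  shows "(\<lambda>x. a \<otimes> p x) \<in> carrier (free_module R X)"
  using assms
  by (intro free_module_carrierI[where A = "{x. p x \<noteq> \<zero>}"])
     (auto simp: free_module_coeff, auto simp: free_module_simps)

lemma free_module_zero_closed: "(\<lambda>_. \<zero>) \<in> carrier (free_module R X)"
  by (auto simp: free_module_simps)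

lemma basis_closed: "x \<in> X \<Longrightarrow> basis R x \<in> carrier (free_module R X)"
  by (rule free_module_carrierI[where A = "{x}"]) (auto simp: basis_def)

lemma module_free_module: "module R (free_module R X)"
proof (rule moduleI)
  show "abelian_group (free_module R X)"
  proof (rule abelian_groupI; unfold free_module_simps(2-4))
    fix p assume p: "p \<in> carrier (free_module R X)"
    have "(\<lambda>x. \<ominus> p x) \<in> carrier (free_module R X)"
      using p by (intro free_module_carrierI[where A = "{x. p x \<noteq> \<zero>}"]) (auto simp: free_module_simps)
    thus "\<exists>q\<in>carrier (free_module R X). (\<lambda>x. q x \<oplus> p x) = (\<lambda>_. \<zero>)"
      using p by (intro bexI[of _ "\<lambda>x. \<ominus> p x"]) (auto simp: free_module_coeff l_neg)
  qed (auto simp: free_module_add_closed free_module_zero_closed free_module_coeff a_ac)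
qed (use is_cring in \<open>auto simp: free_module_simps(2-4) free_module_coeff free_module_smult_closed
      l_distr r_distr m_assoc\<close>)

text \<open>Linear properties need checking on the basis only: setting one coefficient to zero splits off a
  multiple of a basis element and shrinks the support.\<close>

lemma free_module_induct [consumes 1, case_names zero basis add smult]:
  assumes "p \<in> carrier (free_module R X)"
    and zero: "P (\<lambda>_. \<zero>)"
    and basis: "\<And>x. x \<in> X \<Longrightarrow> P (basis R x)"
    and add: "\<And>p q. \<lbrakk>p \<in> carrier (free_module R X); q \<in> carrier (free_module R X); P p; P q\<rbrakk>
      \<Longrightarrow> P (p \<oplus>\<^bsub>free_module R X\<^esub> q)"
    and smult: "\<And>a p. \<lbrakk>a \<in> carrier R; p \<in> carrier (free_module R X); P p\<rbrakk>
      \<Longrightarrow> P (a \<odot>\<^bsub>free_module R X\<^esub> p)"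
  shows "P p"
proof -
  have "P q" if "finite A" "A \<subseteq> X" "q \<in> carrier (free_module R X)" "{x. q x \<noteq> \<zero>} \<subseteq> A" for A q
    using that
  proof (induction A arbitrary: q rule: finite_induct)
    case empty
    hence "q = (\<lambda>_. \<zero>)" by auto
    thus ?case using zero by simp
  next
    case (insert y A)
    let ?r = "q(y := \<zero>)"
    have r: "?r \<in> carrier (free_module R X)"
      using insert by (intro free_module_carrierI[where A = A]) (auto simp: free_module_coeff)
    have "q = ?r \<oplus>\<^bsub>free_module R X\<^esub> (q y \<odot>\<^bsub>free_module R X\<^esub> basis R y)"
      using free_module_coeff[OF insert.prems(2)]
      by (auto simp: free_module_simps(2-4) basis_def fun_eq_iff)
    moreover have "P ?r"
      using insert.prems by (intro insert.IH r) auto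
    moreover have "q y \<odot>\<^bsub>free_module R X\<^esub> basis R y \<in> carrier (free_module R X)"
      using insert by (auto simp: free_module_simps(2-4) free_module_coeff free_module_smult_closed basis_closed)
    ultimately show ?case
      using insert r add smult basis basis_closed free_module_coeff
      by (metis insert_subset)
  qed
  from this[of "{x. p x \<noteq> \<zero>}" p] assms(1) show ?thesis
    by (auto simp: free_module_simps(1))
qed

end

context module
begin

text \<open>The sum over the support has a domain of summation that depends on the argument; a common
  larger domain for several arguments is what makes \<^const>\<open>lin_ext\<close> visibly linear.\<close>

lemma lin_ext_superset:
  assumes "p \<in> carrier (free_module R X)" "finite A" "{x. p x \<noteq> \<zero>} \<subseteq> A"
    and f: "\<And>x. x \<in> A \<Longrightarrow> f x \<in> carrier M"
  shows "lin_ext R M f p = (\<Oplus>\<^bsub>M\<^esub>x\<in>A. p x \<odot>\<^bsub>M\<^esub> f x)"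
  unfolding lin_ext_def using assms
  by (intro M.add.finprod_mono_neutral_cong_left) (auto simp: R.free_module_coeff)

lemma lin_ext_lin_map:
  assumes "f \<in> X \<rightarrow> carrier M"
  shows "lin_ext R M f \<in> lin_map R (free_module R X) M"
proof (rule lin_mapI)
  fix p assume p: "p \<in> carrier (free_module R X)"
  hence "f x \<in> carrier M" if "p x \<noteq> \<zero>" for x
    using that assms by (auto simp: free_module_simps(1))
  thus "lin_ext R M f p \<in> carrier M"
    using R.free_module_coeff[OF p] unfolding lin_ext_def by (intro M.finsum_closed) auto
  fix a assume a: "a \<in> carrier R"
  let ?A = "{x. p x \<noteq> \<zero>}"
  have fA: "finite ?A" "?A \<subseteq> X" using p by (auto simp: free_module_simps(1))
  have "lin_ext R M f (\<lambda>x. a \<otimes> p x) = (\<Oplus>\<^bsub>M\<^esub>x\<in>?A. (a \<otimes> p x) \<odot>\<^bsub>M\<^esub> f x)"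
    using a p assms fA by (intro lin_ext_superset R.free_module_smult_closed) auto
  also have "\<dots> = (\<Oplus>\<^bsub>M\<^esub>x\<in>?A. a \<odot>\<^bsub>M\<^esub> (p x \<odot>\<^bsub>M\<^esub> f x))"
    using a p assms fA by (intro M.finsum_cong') (auto simp: R.free_module_coeff smult_assoc1 Pi_iff subset_iff)
  also have "\<dots> = a \<odot>\<^bsub>M\<^esub> lin_ext R M f p"
    unfolding lin_ext_def using a p assms fA
    by (subst finsum_smult_ldistr) (auto simp: R.free_module_coeff Pi_iff subset_iff)
  finally show "lin_ext R M f (a \<odot>\<^bsub>free_module R X\<^esub> p) = a \<odot>\<^bsub>M\<^esub> lin_ext R M f p"
    by (simp add: free_module_simps)
next
  fix p q assume p: "p \<in> carrier (free_module R X)" and q: "q \<in> carrier (free_module R X)"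
  let ?A = "{x. p x \<noteq> \<zero>} \<union> {x. q x \<noteq> \<zero>}"
  have fA: "finite ?A" "?A \<subseteq> X" using p q by (auto simp: free_module_simps(1))
  have *: "lin_ext R M f r = (\<Oplus>\<^bsub>M\<^esub>x\<in>?A. r x \<odot>\<^bsub>M\<^esub> f x)"
    if "r \<in> carrier (free_module R X)" "{x. r x \<noteq> \<zero>} \<subseteq> ?A" for r
    using that assms fA by (intro lin_ext_superset) auto
  have "lin_ext R M f (\<lambda>x. p x \<oplus> q x) = (\<Oplus>\<^bsub>M\<^esub>x\<in>?A. (p x \<oplus> q x) \<odot>\<^bsub>M\<^esub> f x)"
    using p q by (intro * R.free_module_add_closed) auto
  also have "\<dots> = (\<Oplus>\<^bsub>M\<^esub>x\<in>?A. p x \<odot>\<^bsub>M\<^esub> f x \<oplus>\<^bsub>M\<^esub> q x \<odot>\<^bsub>M\<^esub> f x)"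
    using p q assms fA by (intro M.finsum_cong') (auto simp: R.free_module_coeff smult_l_distr Pi_iff subset_iff)
  also have "\<dots> = lin_ext R M f p \<oplus>\<^bsub>M\<^esub> lin_ext R M f q"
    using p q assms fA
    by (subst M.finsum_addf) (auto simp: * R.free_module_coeff Pi_iff subset_iff)
  finally show "lin_ext R M f (p \<oplus>\<^bsub>free_module R X\<^esub> q) = lin_ext R M f p \<oplus>\<^bsub>M\<^esub> lin_ext R M f q"
    by (simp add: free_module_simps)
qed

lemma lin_ext_basis:
  assumes "f x \<in> carrier M"
  shows "lin_ext R M f (basis R x) = f x"
proof -
  have "lin_ext R M f (basis R x) = (\<Oplus>\<^bsub>M\<^esub>y\<in>{x}. basis R x y \<odot>\<^bsub>M\<^esub> f y)"
    using assms by (intro lin_ext_superset[where X = "{x}"] R.basis_closed) (auto simp: basis_def)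
  thus ?thesis using assms by (simp add: basis_def)
qed

end

text \<open>Both sides are linear in \<open>p\<close>, so it is enough to compare them on basis elements.\<close>

lemma lin_map_lin_ext:
  assumes M: "module k M" and N: "module k N" and q: "q \<in> lin_map k M N"
    and p: "p \<in> carrier (free_module k X)"
    and f: "\<And>x. x \<in> X \<Longrightarrow> f x \<in> carrier M" and g: "\<And>x. x \<in> X \<Longrightarrow> q (f x) = g x"
  shows "q (lin_ext k M f p) = lin_ext k N g p"
proof -
  interpret M: module k M by (fact M)
  interpret N: module k N by (fact N)
  have g': "g x \<in> carrier N" if "x \<in> X" for x
    using lin_map_closed[OF q f[OF that]] g[OF that] by simp
  note F = M.R.module_free_module[of X]
  have lf: "lin_ext k M f \<in> lin_map k (free_module k X) M" by (rule M.lin_ext_lin_map) (auto simp: f)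
  have lg: "lin_ext k N g \<in> lin_map k (free_module k X) N" by (rule N.lin_ext_lin_map) (auto simp: g')
  note lqf = lin_map_comp[OF lf q]
  show ?thesis using p
  proof (induction rule: M.R.free_module_induct)
    case zero
    thus ?case
      using lin_map_zero[OF F N lqf] lin_map_zero[OF F N lg] by (simp add: free_module_simps)
  next
    case (basis x)
    thus ?case using f g g' by (simp add: M.lin_ext_basis N.lin_ext_basis)
  next
    case (add p p')
    thus ?case by (simp add: lin_map_add[OF lqf] lin_map_add[OF lg])
  next
    case (smult a p)
    thus ?case by (simp add: lin_map_smult[OF lqf] lin_map_smult[OF lg])
  qed
qed

section \<open>Algebra morphisms and quotient algebras\<close>

lemma alg_homI: "\<lbrakk>f \<in> lin_map k A B;
    \<And>x y. \<lbrakk>x \<in> carrier A; y \<in> carrier A\<rbrakk> \<Longrightarrow> f (x \<otimes>\<^bsub>A\<^esub> y) = f x \<otimes>\<^bsub>B\<^esub> f y; f \<one>\<^bsub>A\<^esub> = \<one>\<^bsub>B\<^esub>\<rbrakk>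
  \<Longrightarrow> f \<in> alg_hom k A B"
  by (auto simp: alg_hom_def ring_hom_def lin_map_def)

lemma alg_hom_lin: "f \<in> alg_hom k A B \<Longrightarrow> f \<in> lin_map k A B"
  and alg_hom_closed: "\<lbrakk>f \<in> alg_hom k A B; x \<in> carrier A\<rbrakk> \<Longrightarrow> f x \<in> carrier B"
  and alg_hom_mult: "\<lbrakk>f \<in> alg_hom k A B; x \<in> carrier A; y \<in> carrier A\<rbrakk>
    \<Longrightarrow> f (x \<otimes>\<^bsub>A\<^esub> y) = f x \<otimes>\<^bsub>B\<^esub> f y"
  and alg_hom_one: "f \<in> alg_hom k A B \<Longrightarrow> f \<one>\<^bsub>A\<^esub> = \<one>\<^bsub>B\<^esub>"
  by (auto simp: alg_hom_def lin_map_def ring_hom_def)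

lemma alg_hom_comp: "\<lbrakk>f \<in> alg_hom k A B; g \<in> alg_hom k B C\<rbrakk> \<Longrightarrow> (\<lambda>x. g (f x)) \<in> alg_hom k A C"
  by (auto intro!: alg_homI lin_map_comp[of f k A B g C]
      simp: alg_hom_lin alg_hom_closed alg_hom_mult alg_hom_one)

lemma alg_hom_cong:
  assumes "k_algebra k A" "f \<in> alg_hom k A B" "\<And>x. x \<in> carrier A \<Longrightarrow> g x = f x"
  shows "g \<in> alg_hom k A B"
proof -
  interpret k_algebra k A by fact
  show ?thesis using assms(2,3)
    by (intro alg_homI lin_mapI)
       (auto simp: alg_hom_closed alg_hom_mult alg_hom_one lin_map_add[OF alg_hom_lin]
          lin_map_smult[OF alg_hom_lin])
qed

lemma restrict_alg_mor:
  "\<lbrakk>k_algebra k A; f \<in> alg_hom k A B\<rbrakk> \<Longrightarrow> restrict f (carrier A) \<in> alg_mor k A B"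
  unfolding alg_mor_def by (auto intro: alg_hom_cong)

lemma compose_alg_mor:
  assumes "k_algebra k A" "f \<in> alg_mor k A B" "g \<in> alg_mor k B C"
  shows "compose (carrier A) g f \<in> alg_mor k A C"
  using restrict_alg_mor[OF assms(1) alg_hom_comp[of f k A B g C]] assms(2,3)
  by (simp add: alg_mor_def compose_def)

lemma quot_by_simps:
  "carrier (quot_by A I) = a_rcosets\<^bsub>A\<^esub> I"
  "mult (quot_by A I) = rcoset_mult A I"
  "one (quot_by A I) = I +>\<^bsub>A\<^esub> \<one>\<^bsub>A\<^esub>"
  "zero (quot_by A I) = I"
  "add (quot_by A I) = set_add A"
  "smult (quot_by A I) = (\<lambda>a X. \<Union>x\<in>X. I +>\<^bsub>A\<^esub> (a \<odot>\<^bsub>A\<^esub> x))"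
  by (simp_all add: quot_by_def FactRing_def ring.defs module.defs)

lemma ring_quot_by:
  assumes "ring (A Quot I)"
  shows "ring (quot_by A I)"
proof -
  interpret Q: ring "A Quot I" by fact
  have eqs: "carrier (quot_by A I) = carrier (A Quot I)" "mult (quot_by A I) = mult (A Quot I)"
    "one (quot_by A I) = one (A Quot I)" "zero (quot_by A I) = zero (A Quot I)"
    "add (quot_by A I) = add (A Quot I)"
    by (simp_all add: quot_by_simps FactRing_def)
  show ?thesis
  proof (intro ringI abelian_groupI monoidI; unfold eqs)
    fix X assume X: "X \<in> carrier (A Quot I)"
    show "\<exists>Y\<in>carrier (A Quot I). Y \<oplus>\<^bsub>A Quot I\<^esub> X = \<zero>\<^bsub>A Quot I\<^esub>"
      using Q.l_neg[OF X] Q.a_inv_closed[OF X] by blast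
  qed (simp_all add: Q.a_ac Q.m_assoc Q.l_distr Q.r_distr)
qed

lemma a_rcosets_iff: "X \<in> a_rcosets\<^bsub>A\<^esub> I \<longleftrightarrow> (\<exists>x\<in>carrier A. X = I +>\<^bsub>A\<^esub> x)"
  by (auto simp: A_RCOSETS_def')

context k_algebra
begin

text \<open>Scalars act through the unit, as \<open>a x = (a 1) x\<close>.  This is why ideals of the underlying ring
  are enough to form quotients of algebras.\<close>

lemma ideal_smult_closed:
  assumes "ideal I A" "a \<in> carrier k" "x \<in> I"
  shows "a \<odot>\<^bsub>A\<^esub> x \<in> I"
proof -
  interpret ideal I A by fact
  have "(a \<odot>\<^bsub>A\<^esub> \<one>\<^bsub>A\<^esub>) \<otimes>\<^bsub>A\<^esub> x \<in> I" using assms by (intro I_l_closed) auto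
  thus ?thesis using assms by (simp add: smult_mult_left)
qed

text \<open>An ideal is stable under scalars, so all members of the union that defines the scalar multiple of
  a coset are the same coset.\<close>

lemma quot_by_smult:
  assumes "ideal I A" "a \<in> carrier k" "x \<in> carrier A"
  shows "a \<odot>\<^bsub>quot_by A I\<^esub> (I +>\<^bsub>A\<^esub> x) = I +>\<^bsub>A\<^esub> (a \<odot>\<^bsub>A\<^esub> x)"
proof -
  interpret I: ideal I A by fact
  have "I +>\<^bsub>A\<^esub> (a \<odot>\<^bsub>A\<^esub> y) = I +>\<^bsub>A\<^esub> (a \<odot>\<^bsub>A\<^esub> x)" if y: "y \<in> I +>\<^bsub>A\<^esub> x" for y
  proof -
    obtain i where i: "i \<in> I" "y = i \<oplus>\<^bsub>A\<^esub> x" using y by (auto simp: a_r_coset_def')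
    have "a \<odot>\<^bsub>A\<^esub> y = (a \<odot>\<^bsub>A\<^esub> i) \<oplus>\<^bsub>A\<^esub> (a \<odot>\<^bsub>A\<^esub> x)"
      using i assms I.Icarr by (simp add: smult_r_distr)
    moreover have "a \<odot>\<^bsub>A\<^esub> i \<in> I" using assms i by (intro ideal_smult_closed)
    ultimately have "a \<odot>\<^bsub>A\<^esub> y \<in> I +>\<^bsub>A\<^esub> (a \<odot>\<^bsub>A\<^esub> x)" by (auto simp: a_r_coset_def')
    from I.a_repr_independence'[OF this] show ?thesis using assms by simp
  qed
  moreover have "I +>\<^bsub>A\<^esub> x \<noteq> {}" using assms I.a_rcos_self by blast
  ultimately show ?thesis unfolding quot_by_simps(6) by (intro SUP_eq_const)
qed

lemma quot_by_k_algebra: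
  assumes "ideal I A"
  shows "k_algebra k (quot_by A I)"
proof -
  interpret I: ideal I A by fact
  interpret Q: ring "quot_by A I" by (rule ring_quot_by[OF I.quotient_is_ring])
  note simps = quot_by_simps(1,2,5) quot_by_smult[OF assms] a_rcosets_iff
    I.rcoset_mult_add I.a_rcos_sum
  show ?thesis
  proof (intro k_algebra.intro moduleI k_algebra_axioms.intro Q.ring_axioms Q.abelian_group_axioms)
    show "cring k" by (rule R.is_cring)
  qed (auto simp: simps smult_l_distr smult_r_distr smult_assoc1 smult_mult_left smult_mult_right)
qed

lemma quot_by_proj:
  assumes "ideal I A"
  shows "(\<lambda>x. I +>\<^bsub>A\<^esub> x) \<in> alg_hom k A (quot_by A I)"
proof -
  interpret I: ideal I A by fact
  show ?thesis
    by (intro alg_homI lin_mapI)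
       (auto simp: quot_by_simps(1-5) quot_by_smult[OF assms] a_rcosets_iff I.rcoset_mult_add I.a_rcos_sum)
qed

lemma quot_by_proj_eq_zero:
  assumes "ideal I A" "x \<in> I"
  shows "I +>\<^bsub>A\<^esub> x = \<zero>\<^bsub>quot_by A I\<^esub>"
proof -
  interpret I: ideal I A by fact
  show ?thesis using assms by (simp add: quot_by_simps I.a_rcos_const)
qed

lemma quot_by_proj_eq:
  assumes I: "ideal I A" and "x \<in> carrier A" "y \<in> carrier A" "x \<ominus>\<^bsub>A\<^esub> y \<in> I"
  shows "I +>\<^bsub>A\<^esub> x = I +>\<^bsub>A\<^esub> y"
proof -
  interpret I: ideal I A by fact
  show ?thesis using assms(2-4) A.quotient_eq_iff_same_a_r_cos[OF I] by blast
qed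

lemma quot_by_factor:
  assumes I: "ideal I A" and B: "k_algebra k B" and f: "f \<in> alg_hom k A B"
    and z: "\<And>x. x \<in> I \<Longrightarrow> f x = \<zero>\<^bsub>B\<^esub>"
  obtains f' where "f' \<in> alg_hom k (quot_by A I) B" "\<And>x. x \<in> carrier A \<Longrightarrow> f' (I +>\<^bsub>A\<^esub> x) = f x"
proof -
  interpret I: ideal I A by fact
  interpret B: k_algebra k B by fact
  define f' where "f' X = f (SOME x. x \<in> X)" for X
  have *: "f' (I +>\<^bsub>A\<^esub> x) = f x" if x: "x \<in> carrier A" for x
  proof -
    have "x \<in> I +>\<^bsub>A\<^esub> x" using x I.a_rcos_self by blast
    hence "(SOME y. y \<in> I +>\<^bsub>A\<^esub> x) \<in> I +>\<^bsub>A\<^esub> x" by (rule someI)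
    then obtain i where i: "i \<in> I" "(SOME y. y \<in> I +>\<^bsub>A\<^esub> x) = i \<oplus>\<^bsub>A\<^esub> x" by (auto simp: a_r_coset_def')
    thus ?thesis using x z I.Icarr alg_hom_closed[OF f]
      by (simp add: f'_def lin_map_add[OF alg_hom_lin[OF f]])
  qed
  have "f' \<in> alg_hom k (quot_by A I) B"
    by (intro alg_homI lin_mapI)
       (auto simp: quot_by_simps(1-5) quot_by_smult[OF I] a_rcosets_iff I.rcoset_mult_add I.a_rcos_sum *
          alg_hom_closed[OF f] lin_map_add[OF alg_hom_lin[OF f]] lin_map_smult[OF alg_hom_lin[OF f]]
          alg_hom_mult[OF f] alg_hom_one[OF f])
  thus thesis using that * by blast
qed

end

section \<open>The free algebra\<close>

lemma free_alg_simps: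
  "carrier (free_alg k X) = carrier (free_module k (lists X))"
  "zero (free_alg k X) = zero (free_module k (lists X))"
  "add (free_alg k X) = add (free_module k (lists X))"
  "smult (free_alg k X) = smult (free_module k (lists X))"
  "mult (free_alg k X) = (\<lambda>p q w. \<Oplus>\<^bsub>k\<^esub>i\<in>{..length w}. p (take i w) \<otimes>\<^bsub>k\<^esub> q (drop i w))"
  "one (free_alg k X) = basis k []"
  by (simp_all add: free_alg_def)

lemma lin_map_free_alg: "lin_map k (free_module k (lists X)) M = lin_map k (free_alg k X) M"
  by (simp add: lin_map_def free_alg_simps)

context cring
begin

lemma module_free_alg: "module R (free_alg R X)"
proof -
  interpret F: module R "free_module R (lists X)" by (rule module_free_module)
  show ?thesis
  proof (rule moduleI)
    show "abelian_group (free_alg R X)"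
      by (rule abelian_groupI; unfold free_alg_simps)
         (auto intro: F.M.a_assoc F.M.a_comm F.M.l_neg F.M.a_inv_closed)
  qed (auto simp: free_alg_simps F.smult_l_distr F.smult_r_distr F.smult_assoc1 is_cring)
qed

lemmas free_alg_coeff = free_module_coeff[where X = "lists X" for X, folded free_alg_simps(1)]
lemmas free_alg_basis_closed = basis_closed[where X = "lists X" for X, folded free_alg_simps(1)]
lemmas free_alg_induct = free_module_induct[where X = "lists X" for X, folded free_alg_simps(1,3,4),
    consumes 1, case_names zero basis add smult]

text \<open>A word in the support of a product is a concatenation of words in the supports of the two
  factors, and there are finitely many of these.\<close>

lemma free_alg_mult_closed:
  assumes p: "p \<in> carrier (free_alg R X)" and q: "q \<in> carrier (free_alg R X)"
  shows "p \<otimes>\<^bsub>free_alg R X\<^esub> q \<in> carrier (free_alg R X)"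
proof -
  let ?P = "{u. p u \<noteq> \<zero>}" and ?Q = "{v. q v \<noteq> \<zero>}"
  have fin: "finite ?P" "finite ?Q" "?P \<subseteq> lists X" "?Q \<subseteq> lists X"
    using p q by (auto simp: free_alg_simps free_module_simps(1))
  have "(p \<otimes>\<^bsub>free_alg R X\<^esub> q) w = \<zero>" if w: "w \<notin> (\<lambda>(u, v). u @ v) ` (?P \<times> ?Q)" for w
  proof -
    have "p (take i w) = \<zero> \<or> q (drop i w) = \<zero>" for i
      using w by (force simp: image_iff)
    hence "p (take i w) \<otimes> q (drop i w) = \<zero>" for i
      using free_alg_coeff[OF p] free_alg_coeff[OF q] by (metis l_null r_null)
    thus ?thesis by (simp add: free_alg_simps)
  qed
  moreover have "(p \<otimes>\<^bsub>free_alg R X\<^esub> q) w \<in> carrier R" for w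
    using free_alg_coeff[OF p] free_alg_coeff[OF q] by (auto simp: free_alg_simps intro!: finsum_closed)
  moreover have "finite ((\<lambda>(u, v). u @ v) ` (?P \<times> ?Q))" using fin(1,2) by blast
  moreover have "(\<lambda>(u, v). u @ v) ` (?P \<times> ?Q) \<subseteq> lists X"
    using fin(3,4) unfolding lists_eq_set by fastforce
  ultimately show ?thesis
    unfolding free_alg_simps(1) by (intro free_module_carrierI) auto
qed

lemma free_alg_mult_lin_left:
  assumes q: "q \<in> carrier (free_alg R X)"
  shows "(\<lambda>p. p \<otimes>\<^bsub>free_alg R X\<^esub> q) \<in> lin_map R (free_alg R X) (free_alg R X)"
proof (rule lin_mapI[OF free_alg_mult_closed[OF _ q]])
  fix p p' assume p: "p \<in> carrier (free_alg R X)" and p': "p' \<in> carrier (free_alg R X)"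
  note c = free_alg_coeff[OF p] free_alg_coeff[OF p'] free_alg_coeff[OF q]
  show "(p \<oplus>\<^bsub>free_alg R X\<^esub> p') \<otimes>\<^bsub>free_alg R X\<^esub> q
      = p \<otimes>\<^bsub>free_alg R X\<^esub> q \<oplus>\<^bsub>free_alg R X\<^esub> p' \<otimes>\<^bsub>free_alg R X\<^esub> q"
    by (auto simp: free_alg_simps free_module_simps c l_distr fun_eq_iff intro!: finsum_addf)
next
  fix a p assume a: "a \<in> carrier R" and p: "p \<in> carrier (free_alg R X)"
  note c = free_alg_coeff[OF p] free_alg_coeff[OF q]
  show "(a \<odot>\<^bsub>free_alg R X\<^esub> p) \<otimes>\<^bsub>free_alg R X\<^esub> q = a \<odot>\<^bsub>free_alg R X\<^esub> (p \<otimes>\<^bsub>free_alg R X\<^esub> q)"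
    using a by (auto simp: free_alg_simps free_module_simps c m_assoc fun_eq_iff finsum_rdistr)
qed

lemma free_alg_mult_lin_right:
  assumes p: "p \<in> carrier (free_alg R X)"
  shows "(\<lambda>q. p \<otimes>\<^bsub>free_alg R X\<^esub> q) \<in> lin_map R (free_alg R X) (free_alg R X)"
proof (rule lin_mapI[OF free_alg_mult_closed[OF p]])
  fix q q' assume q: "q \<in> carrier (free_alg R X)" and q': "q' \<in> carrier (free_alg R X)"
  note c = free_alg_coeff[OF q] free_alg_coeff[OF q'] free_alg_coeff[OF p]
  show "p \<otimes>\<^bsub>free_alg R X\<^esub> (q \<oplus>\<^bsub>free_alg R X\<^esub> q')
      = p \<otimes>\<^bsub>free_alg R X\<^esub> q \<oplus>\<^bsub>free_alg R X\<^esub> p \<otimes>\<^bsub>free_alg R X\<^esub> q'"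
    by (auto simp: free_alg_simps free_module_simps c r_distr fun_eq_iff intro!: finsum_addf)
next
  fix a q assume a: "a \<in> carrier R" and q: "q \<in> carrier (free_alg R X)"
  note c = free_alg_coeff[OF p] free_alg_coeff[OF q]
  show "p \<otimes>\<^bsub>free_alg R X\<^esub> (a \<odot>\<^bsub>free_alg R X\<^esub> q) = a \<odot>\<^bsub>free_alg R X\<^esub> (p \<otimes>\<^bsub>free_alg R X\<^esub> q)"
    using a by (auto simp: free_alg_simps free_module_simps c m_lcomm fun_eq_iff finsum_rdistr)
qed

text \<open>Among all cuts of a word in two, only the cut after \<open>length u\<close> letters can produce \<open>u\<close> and \<open>v\<close>.\<close>

lemma free_alg_mult_basis:
  "basis R u \<otimes>\<^bsub>free_alg R X\<^esub> basis R v = basis R (u @ v)"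
proof
  fix w
  show "(basis R u \<otimes>\<^bsub>free_alg R X\<^esub> basis R v) w = basis R (u @ v) w"
  proof (cases "w = u @ v")
    case True
    have "basis R u (take i w) \<otimes> basis R v (drop i w) = (if length u = i then \<one> else \<zero>)"
      if "i \<le> length w" for i
      using that True by (auto simp: basis_def append_eq_conv_conj dest: arg_cong[where f = length])
    hence "(basis R u \<otimes>\<^bsub>free_alg R X\<^esub> basis R v) w
        = (\<Oplus>i\<in>{..length w}. if length u = i then \<one> else \<zero>)"
      by (auto simp: free_alg_simps intro!: finsum_cong')
    also have "\<dots> = \<one>" using True by (subst add.finprod_singleton) auto
    finally show ?thesis using True by (simp add: basis_def)
  next
    case False
    hence "basis R u (take i w) \<otimes> basis R v (drop i w) = \<zero>" for i
      by (auto simp: basis_def)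
    thus ?thesis using False by (simp add: free_alg_simps basis_def)
  qed
qed

lemma free_alg_lin_map_eqI:
  assumes "module R M" "f \<in> lin_map R (free_alg R X) M" "g \<in> lin_map R (free_alg R X) M"
    and "\<And>w. w \<in> lists X \<Longrightarrow> f (basis R w) = g (basis R w)" and "p \<in> carrier (free_alg R X)"
  shows "f p = g p"
  using assms(5)
proof (induction rule: free_alg_induct)
  case zero
  show ?case
    using lin_map_zero[OF module_free_alg assms(1,2)] lin_map_zero[OF module_free_alg assms(1,3)]
    by (simp add: free_alg_simps free_module_simps)
qed (simp_all add: assms(4) lin_map_add[OF assms(2)] lin_map_add[OF assms(3)]
       lin_map_smult[OF assms(2)] lin_map_smult[OF assms(3)])

text \<open>Multiplication is linear in each factor, so associativity may be checked on words one factor at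
  a time; for words it is associativity of concatenation.\<close>

lemma free_alg_k_algebra: "k_algebra R (free_alg R X)"
proof -
  let ?F = "free_alg R X"
  interpret F: module R ?F by (rule module_free_alg)
  note L = free_alg_mult_lin_left and R = free_alg_mult_lin_right
  have one: "\<one>\<^bsub>?F\<^esub> \<in> carrier ?F" unfolding free_alg_simps(6) by (rule free_alg_basis_closed) simp
  have id: "(\<lambda>p. p) \<in> lin_map R ?F ?F" by (rule lin_mapI) auto
  have lone: "\<one>\<^bsub>?F\<^esub> \<otimes>\<^bsub>?F\<^esub> p = p" if "p \<in> carrier ?F" for p
    by (rule free_alg_lin_map_eqI[OF F.module_axioms R[OF one] id _ that])
       (simp add: free_alg_simps(6) free_alg_mult_basis)
  have rone: "p \<otimes>\<^bsub>?F\<^esub> \<one>\<^bsub>?F\<^esub> = p" if "p \<in> carrier ?F" for p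
    by (rule free_alg_lin_map_eqI[OF F.module_axioms L[OF one] id _ that])
       (simp add: free_alg_simps(6) free_alg_mult_basis)
  note b = free_alg_basis_closed and m = free_alg_mult_closed
  have assoc_bb: "(basis R u \<otimes>\<^bsub>?F\<^esub> basis R v) \<otimes>\<^bsub>?F\<^esub> r = basis R u \<otimes>\<^bsub>?F\<^esub> (basis R v \<otimes>\<^bsub>?F\<^esub> r)"
    if "u \<in> lists X" "v \<in> lists X" "r \<in> carrier ?F" for u v r
    by (rule free_alg_lin_map_eqI[OF F.module_axioms _ _ _ that(3)])
       (use that in \<open>auto intro!: R lin_map_comp[OF R R] b m simp: free_alg_mult_basis\<close>)
  have assoc_b: "(basis R u \<otimes>\<^bsub>?F\<^esub> q) \<otimes>\<^bsub>?F\<^esub> r = basis R u \<otimes>\<^bsub>?F\<^esub> (q \<otimes>\<^bsub>?F\<^esub> r)"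
    if "u \<in> lists X" "q \<in> carrier ?F" "r \<in> carrier ?F" for u q r
    by (rule free_alg_lin_map_eqI[OF F.module_axioms lin_map_comp[OF R L] lin_map_comp[OF L R] _ that(2)])
       (use that in \<open>auto intro!: b m assoc_bb\<close>)
  have assoc: "(p \<otimes>\<^bsub>?F\<^esub> q) \<otimes>\<^bsub>?F\<^esub> r = p \<otimes>\<^bsub>?F\<^esub> (q \<otimes>\<^bsub>?F\<^esub> r)"
    if "p \<in> carrier ?F" "q \<in> carrier ?F" "r \<in> carrier ?F" for p q r
    by (rule free_alg_lin_map_eqI[OF F.module_axioms lin_map_comp[OF L L] L _ that(1)])
       (use that in \<open>auto intro!: b m assoc_b\<close>)
  show ?thesis
  proof (intro k_algebra.intro F.module_axioms ringI monoidI k_algebra_axioms.intro)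
    show "abelian_group ?F" by (rule F.abelian_group_axioms)
  qed (simp_all add: m one lone rone assoc lin_map_add[OF L] lin_map_add[OF R]
        lin_map_smult[OF L] lin_map_smult[OF R])
qed

end

definition word_value :: "('a, 'm) monoid_scheme \<Rightarrow> ('x \<Rightarrow> 'a) \<Rightarrow> 'x list \<Rightarrow> 'a"
  where "word_value A f w = foldr (\<lambda>x y. f x \<otimes>\<^bsub>A\<^esub> y) w \<one>\<^bsub>A\<^esub>"

lemma word_value_simps [simp]:
  "word_value A f [] = \<one>\<^bsub>A\<^esub>"
  "word_value A f (x # w) = f x \<otimes>\<^bsub>A\<^esub> word_value A f w"
  by (simp_all add: word_value_def)

context k_algebra
begin

lemma word_value_closed:
  "\<lbrakk>f \<in> X \<rightarrow> carrier A; w \<in> lists X\<rbrakk> \<Longrightarrow> word_value A f w \<in> carrier A"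
  by (induction w) auto

lemma word_value_append:
  assumes "f \<in> X \<rightarrow> carrier A" "u \<in> lists X" "v \<in> lists X"
  shows "word_value A f (u @ v) = word_value A f u \<otimes>\<^bsub>A\<^esub> word_value A f v"
  using assms(2)
proof (induction u)
  case (Cons x u)
  have "f x \<in> carrier A" "word_value A f u \<in> carrier A" "word_value A f v \<in> carrier A"
    using Cons assms by (auto intro: word_value_closed)
  thus ?case using Cons by (simp add: A.m_assoc)
qed (simp add: word_value_closed[OF assms(1,3)])

lemma mult_lin_left: "y \<in> carrier A \<Longrightarrow> (\<lambda>x. x \<otimes>\<^bsub>A\<^esub> y) \<in> lin_map k A A"
  and mult_lin_right: "y \<in> carrier A \<Longrightarrow> (\<lambda>x. y \<otimes>\<^bsub>A\<^esub> x) \<in> lin_map k A A"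
  by (auto intro!: lin_mapI simp: A.l_distr A.r_distr smult_mult_left smult_mult_right)

text \<open>Both sides of multiplicativity are linear in each factor, so it reduces to
  \<open>word_value_append\<close>.\<close>

lemma free_alg_lift:
  assumes f: "f \<in> X \<rightarrow> carrier A"
  shows "lin_ext k A (word_value A f) \<in> alg_hom k (free_alg k X) A"
proof -
  let ?F = "free_alg k X" and ?l = "lin_ext k A (word_value A f)"
  interpret F: k_algebra k ?F by (rule R.free_alg_k_algebra)
  have l: "?l \<in> lin_map k ?F A"
    unfolding lin_map_free_alg[symmetric] by (rule lin_ext_lin_map) (use f word_value_closed in blast)
  have lb: "?l (basis k w) = word_value A f w" if "w \<in> lists X" for w
    using that f by (intro lin_ext_basis word_value_closed)
  note b = R.free_alg_basis_closed
  have mult_b: "?l (basis k u \<otimes>\<^bsub>?F\<^esub> q) = ?l (basis k u) \<otimes>\<^bsub>A\<^esub> ?l q"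
    if "u \<in> lists X" "q \<in> carrier ?F" for u q
    by (rule R.free_alg_lin_map_eqI[OF module_axioms lin_map_comp[OF F.mult_lin_right l]
          lin_map_comp[OF l mult_lin_right] _ that(2)])
       (use that f in \<open>auto intro!: b lin_map_closed[OF l] word_value_closed[OF f]
          simp: R.free_alg_mult_basis lb word_value_append\<close>)
  have mult: "?l (p \<otimes>\<^bsub>?F\<^esub> q) = ?l p \<otimes>\<^bsub>A\<^esub> ?l q"
    if "p \<in> carrier ?F" "q \<in> carrier ?F" for p q
    by (rule R.free_alg_lin_map_eqI[OF module_axioms lin_map_comp[OF F.mult_lin_left l]
          lin_map_comp[OF l mult_lin_left] _ that(1)])
       (use that in \<open>auto intro!: lin_map_closed[OF l] simp: mult_b\<close>)
  show ?thesis
    by (rule alg_homI[OF l]) (auto simp: mult free_alg_simps(6) lb)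
qed

lemma free_alg_lift_basis:
  assumes "f \<in> X \<rightarrow> carrier A" "w \<in> lists X"
  shows "lin_ext k A (word_value A f) (basis k w) = word_value A f w"
  using assms by (intro lin_ext_basis word_value_closed)

lemma free_alg_hom_eqI:
  assumes f: "f \<in> alg_hom k (free_alg k X) A" and g: "g \<in> alg_hom k (free_alg k X) A"
    and eq: "\<And>x. x \<in> X \<Longrightarrow> f (basis k [x]) = g (basis k [x])" and p: "p \<in> carrier (free_alg k X)"
  shows "f p = g p"
proof (rule R.free_alg_lin_map_eqI[OF module_axioms alg_hom_lin[OF f] alg_hom_lin[OF g] _ p])
  fix w assume "w \<in> lists X"
  thus "f (basis k w) = g (basis k w)"
  proof (induction w)
    case Nil
    show ?case using alg_hom_one[OF f] alg_hom_one[OF g] by (simp add: free_alg_simps(6))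
  next
    case (Cons x w)
    have "basis k (x # w) = basis k [x] \<otimes>\<^bsub>free_alg k X\<^esub> basis k w"
      by (simp add: R.free_alg_mult_basis)
    thus ?case using Cons eq
      by (simp add: alg_hom_mult[OF f] alg_hom_mult[OF g] R.free_alg_basis_closed)
  qed
qed

end

section \<open>The tensor algebra\<close>

context module
begin

abbreviation (input) "FA \<equiv> free_alg R (carrier M)"

lemma multilin_rels_cases:
  assumes "r \<in> multilin_rels R M"
  obtains (add) u v x y where
      "r = basis R (u @ [x \<oplus>\<^bsub>M\<^esub> y] @ v)
        \<ominus>\<^bsub>FA\<^esub> (basis R (u @ [x] @ v) \<oplus>\<^bsub>FA\<^esub> basis R (u @ [y] @ v))"
      "u \<in> lists (carrier M)" "v \<in> lists (carrier M)" "x \<in> carrier M" "y \<in> carrier M"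
    | (smult) a u v x where
      "r = basis R (u @ [a \<odot>\<^bsub>M\<^esub> x] @ v) \<ominus>\<^bsub>FA\<^esub> a \<odot>\<^bsub>FA\<^esub> basis R (u @ [x] @ v)"
      "a \<in> carrier R" "u \<in> lists (carrier M)" "v \<in> lists (carrier M)" "x \<in> carrier M"
  using assms unfolding multilin_rels_def Let_def
  by (elim UnE CollectE exE conjE) (erule (4) that(1), erule (4) that(2))

lemma multilin_rels_add:
  "\<lbrakk>u \<in> lists (carrier M); v \<in> lists (carrier M); x \<in> carrier M; y \<in> carrier M\<rbrakk> \<Longrightarrow>
    basis R (u @ [x \<oplus>\<^bsub>M\<^esub> y] @ v)
        \<ominus>\<^bsub>FA\<^esub> (basis R (u @ [x] @ v) \<oplus>\<^bsub>FA\<^esub> basis R (u @ [y] @ v)) \<in> multilin_rels R M"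
  unfolding multilin_rels_def Let_def
  by (rule UnI1, rule CollectI, (rule exI)+, rule conjI, rule refl, intro conjI)

lemma multilin_rels_smult:
  "\<lbrakk>a \<in> carrier R; u \<in> lists (carrier M); v \<in> lists (carrier M); x \<in> carrier M\<rbrakk> \<Longrightarrow>
    basis R (u @ [a \<odot>\<^bsub>M\<^esub> x] @ v) \<ominus>\<^bsub>FA\<^esub> a \<odot>\<^bsub>FA\<^esub> basis R (u @ [x] @ v) \<in> multilin_rels R M"
  unfolding multilin_rels_def Let_def
  by (rule UnI2, rule CollectI, (rule exI)+, rule conjI, rule refl, intro conjI)

text \<open>A linear map sends a multilinearity relation to the same expression in its values on words.  The
  lemma is used for the two multiplications by a word, for the identity, and for the map that
  evaluates words in an algebra.\<close>

lemma lin_map_multilin_rels: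
  assumes N: "module R N" and f: "f \<in> lin_map R FA N" and K: "r \<in> multilin_rels R M"
    and add: "\<And>u v x y. \<lbrakk>u \<in> lists (carrier M); v \<in> lists (carrier M); x \<in> carrier M; y \<in> carrier M\<rbrakk> \<Longrightarrow>
      f (basis R (u @ [x \<oplus>\<^bsub>M\<^esub> y] @ v)) \<ominus>\<^bsub>N\<^esub>
        (f (basis R (u @ [x] @ v)) \<oplus>\<^bsub>N\<^esub> f (basis R (u @ [y] @ v))) \<in> K"
    and smult: "\<And>a u v x. \<lbrakk>a \<in> carrier R; u \<in> lists (carrier M); v \<in> lists (carrier M); x \<in> carrier M\<rbrakk> \<Longrightarrow>
      f (basis R (u @ [a \<odot>\<^bsub>M\<^esub> x] @ v)) \<ominus>\<^bsub>N\<^esub> a \<odot>\<^bsub>N\<^esub> f (basis R (u @ [x] @ v)) \<in> K"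
  shows "f r \<in> K"
proof -
  interpret F: k_algebra R FA by (rule R.free_alg_k_algebra)
  have b: "basis R w \<in> carrier FA" if "w \<in> lists (carrier M)" for w
    using that by (rule R.free_alg_basis_closed)
  show ?thesis using K
  proof (cases rule: multilin_rels_cases)
    case (add u v x y)
    have "basis R (u @ [x \<oplus>\<^bsub>M\<^esub> y] @ v) \<in> carrier FA" "basis R (u @ [x] @ v) \<in> carrier FA"
      "basis R (u @ [y] @ v) \<in> carrier FA"
      using add by (auto intro!: b)
    thus ?thesis
      using add assms(4)[of u v x y]
      by (simp add: lin_map_minus[OF F.module_axioms N f] lin_map_add[OF f] del: append_Cons append_Nil)
  next
    case (smult a u v x)
    have "basis R (u @ [a \<odot>\<^bsub>M\<^esub> x] @ v) \<in> carrier FA" "basis R (u @ [x] @ v) \<in> carrier FA"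
      using smult by (auto intro!: b)
    thus ?thesis
      using smult assms(5)[of a u v x]
      by (simp add: lin_map_minus[OF F.module_axioms N f] lin_map_smult[OF f] del: append_Cons append_Nil)
  qed
qed

lemma multilin_rels_closed: "multilin_rels R M \<subseteq> carrier FA"
proof
  fix r assume r: "r \<in> multilin_rels R M"
  interpret F: k_algebra R FA by (rule R.free_alg_k_algebra)
  have "(\<lambda>p. p) \<in> lin_map R FA FA" by (rule lin_mapI) auto
  from lin_map_multilin_rels[OF F.module_axioms this r, of "carrier FA"]
  show "r \<in> carrier FA" by (auto simp: R.free_alg_basis_closed)
qed

text \<open>Multiplying a relation by a word, on either side, only lengthens the words that surround the
  letter concerned, so it gives a relation again.  By linearity the span of the relations is stable
  under multiplication by words and therefore by all elements.\<close>

lemma multilin_sub_ideal: "ideal (multilin_sub R M) FA"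
proof -
  interpret F: k_algebra R FA by (rule R.free_alg_k_algebra)
  let ?I = "multilin_sub R M"
  have sub: "submodule ?I R FA"
    unfolding multilin_sub_def by (rule F.span_of_submodule[OF multilin_rels_closed])
  have base: "multilin_rels R M \<subseteq> ?I"
    unfolding multilin_sub_def by (rule span_of_base)
  note subE = F.submoduleE[OF sub]
  have zero_in: "\<zero>\<^bsub>FA\<^esub> \<in> ?I" using subgroup.one_closed[OF submodule.axioms(1)[OF sub]] by simp
  have L: "f r \<in> ?I" if "f \<in> lin_map R FA FA" "f ` multilin_rels R M \<subseteq> multilin_rels R M" "r \<in> ?I" for f r
    using lin_map_span_subset[OF F.module_axioms F.module_axioms that(1) multilin_rels_closed sub]
      that(2,3) base unfolding multilin_sub_def by blast
  have left: "basis R w \<otimes>\<^bsub>FA\<^esub> r \<in> ?I" if w: "w \<in> lists (carrier M)" and r: "r \<in> ?I" for w r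
  proof (rule L[OF F.mult_lin_right _ r])
    show "basis R w \<in> carrier FA" using w by (rule R.free_alg_basis_closed)
    show "(\<otimes>\<^bsub>FA\<^esub>) (basis R w) ` multilin_rels R M \<subseteq> multilin_rels R M"
    proof (rule image_subsetI, rule lin_map_multilin_rels[OF F.module_axioms F.mult_lin_right])
      show "basis R w \<in> carrier FA" using w by (rule R.free_alg_basis_closed)
    next
      fix u v x y assume "u \<in> lists (carrier M)" "v \<in> lists (carrier M)" "x \<in> carrier M" "y \<in> carrier M"
      thus "basis R w \<otimes>\<^bsub>FA\<^esub> basis R (u @ [x \<oplus>\<^bsub>M\<^esub> y] @ v) \<ominus>\<^bsub>FA\<^esub>
         (basis R w \<otimes>\<^bsub>FA\<^esub> basis R (u @ [x] @ v) \<oplus>\<^bsub>FA\<^esub>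
          basis R w \<otimes>\<^bsub>FA\<^esub> basis R (u @ [y] @ v)) \<in> multilin_rels R M"
        using multilin_rels_add[of "w @ u" v x y] w by (simp add: R.free_alg_mult_basis)
    next
      fix a u v x assume "a \<in> carrier R" "u \<in> lists (carrier M)" "v \<in> lists (carrier M)" "x \<in> carrier M"
      thus "basis R w \<otimes>\<^bsub>FA\<^esub> basis R (u @ [a \<odot>\<^bsub>M\<^esub> x] @ v) \<ominus>\<^bsub>FA\<^esub>
         a \<odot>\<^bsub>FA\<^esub> (basis R w \<otimes>\<^bsub>FA\<^esub> basis R (u @ [x] @ v)) \<in> multilin_rels R M"
        using multilin_rels_smult[of a "w @ u" v x] w by (simp add: R.free_alg_mult_basis)
    qed
  qed
  have right: "r \<otimes>\<^bsub>FA\<^esub> basis R w \<in> ?I" if w: "w \<in> lists (carrier M)" and r: "r \<in> ?I" for w r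
  proof (rule L[where f = "\<lambda>r. r \<otimes>\<^bsub>FA\<^esub> basis R w", OF F.mult_lin_left _ r])
    show "basis R w \<in> carrier FA" using w by (rule R.free_alg_basis_closed)
    show "(\<lambda>r. r \<otimes>\<^bsub>FA\<^esub> basis R w) ` multilin_rels R M \<subseteq> multilin_rels R M"
    proof (rule image_subsetI, rule lin_map_multilin_rels[OF F.module_axioms F.mult_lin_left])
      show "basis R w \<in> carrier FA" using w by (rule R.free_alg_basis_closed)
    next
      fix u v x y assume "u \<in> lists (carrier M)" "v \<in> lists (carrier M)" "x \<in> carrier M" "y \<in> carrier M"
      thus "basis R (u @ [x \<oplus>\<^bsub>M\<^esub> y] @ v) \<otimes>\<^bsub>FA\<^esub> basis R w \<ominus>\<^bsub>FA\<^esub>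
         (basis R (u @ [x] @ v) \<otimes>\<^bsub>FA\<^esub> basis R w \<oplus>\<^bsub>FA\<^esub>
          basis R (u @ [y] @ v) \<otimes>\<^bsub>FA\<^esub> basis R w) \<in> multilin_rels R M"
        using multilin_rels_add[of u "v @ w" x y] w by (simp add: R.free_alg_mult_basis)
    next
      fix a u v x assume "a \<in> carrier R" "u \<in> lists (carrier M)" "v \<in> lists (carrier M)" "x \<in> carrier M"
      thus "basis R (u @ [a \<odot>\<^bsub>M\<^esub> x] @ v) \<otimes>\<^bsub>FA\<^esub> basis R w \<ominus>\<^bsub>FA\<^esub>
         a \<odot>\<^bsub>FA\<^esub> (basis R (u @ [x] @ v) \<otimes>\<^bsub>FA\<^esub> basis R w) \<in> multilin_rels R M"
        using multilin_rels_smult[of a u "v @ w" x] w by (simp add: R.free_alg_mult_basis)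
    qed
  qed
  show ?thesis
  proof (rule idealI)
    show "ring FA" by (rule F.A.ring_axioms)
    show "subgroup ?I (add_monoid FA)" by (rule submodule.axioms(1)[OF sub])
  next
    fix r p assume r: "r \<in> ?I" and p: "p \<in> carrier FA"
    have rF: "r \<in> carrier FA" using r subE(1) by blast
    note Lr = F.mult_lin_left[OF rF] and Rr = F.mult_lin_right[OF rF]
    show "p \<otimes>\<^bsub>FA\<^esub> r \<in> ?I" using p
    proof (induction rule: R.free_alg_induct)
      case zero
      show ?case using lin_map_zero[OF F.module_axioms F.module_axioms Lr] zero_in
        by (simp add: free_alg_simps(2) free_module_simps(2))
    next
      case (basis w)
      thus ?case using left r by blast
    qed (simp_all add: lin_map_add[OF Lr] lin_map_smult[OF Lr] subE)
    show "r \<otimes>\<^bsub>FA\<^esub> p \<in> ?I" using p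
    proof (induction rule: R.free_alg_induct)
      case zero
      show ?case using lin_map_zero[OF F.module_axioms F.module_axioms Rr] zero_in
        by (simp add: free_alg_simps(2) free_module_simps(2))
    next
      case (basis w)
      thus ?case using right r by blast
    qed (simp_all add: lin_map_add[OF Rr] lin_map_smult[OF Rr] subE)
  qed
qed

lemma tensor_algebra_k_algebra: "k_algebra R (tensor_algebra R M)"
  unfolding tensor_algebra_def
  by (rule k_algebra.quot_by_k_algebra[OF R.free_alg_k_algebra multilin_sub_ideal])

text \<open>Linearity of the inclusion of generators is what the relations with empty surrounding words say.\<close>

lemma tensor_gen_lin: "tensor_gen R M \<in> lin_map R M (tensor_algebra R M)"
proof -
  interpret F: k_algebra R FA by (rule R.free_alg_k_algebra)
  note proj = F.quot_by_proj[OF multilin_sub_ideal, folded tensor_algebra_def]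
  note eq = F.quot_by_proj_eq[OF multilin_sub_ideal]
  have b: "basis R [x] \<in> carrier FA" if "x \<in> carrier M" for x
    using that by (intro R.free_alg_basis_closed) simp
  have rels: "r \<in> multilin_sub R M" if "r \<in> multilin_rels R M" for r
    unfolding multilin_sub_def by (rule subsetD[OF span_of_base that])
  show ?thesis
  proof (rule lin_mapI)
    fix x assume x: "x \<in> carrier M"
    thus "tensor_gen R M x \<in> carrier (tensor_algebra R M)"
      unfolding tensor_gen_def using alg_hom_closed[OF proj b] by simp
    fix y assume y: "y \<in> carrier M"
    have "tensor_gen R M (x \<oplus>\<^bsub>M\<^esub> y) = multilin_sub R M +>\<^bsub>FA\<^esub> (basis R [x] \<oplus>\<^bsub>FA\<^esub> basis R [y])"
      unfolding tensor_gen_def using x y multilin_rels_add[of "[]" "[]" x y]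
      by (intro eq rels) (auto simp: b)
    thus "tensor_gen R M (x \<oplus>\<^bsub>M\<^esub> y) = tensor_gen R M x \<oplus>\<^bsub>tensor_algebra R M\<^esub> tensor_gen R M y"
      using x y by (simp add: tensor_gen_def lin_map_add[OF alg_hom_lin[OF proj]] b)
  next
    fix a x assume a: "a \<in> carrier R" and x: "x \<in> carrier M"
    have "tensor_gen R M (a \<odot>\<^bsub>M\<^esub> x) = multilin_sub R M +>\<^bsub>FA\<^esub> (a \<odot>\<^bsub>FA\<^esub> basis R [x])"
      unfolding tensor_gen_def using a x multilin_rels_smult[of a "[]" "[]" x]
      by (intro eq rels) (auto simp: b)
    thus "tensor_gen R M (a \<odot>\<^bsub>M\<^esub> x) = a \<odot>\<^bsub>tensor_algebra R M\<^esub> tensor_gen R M x"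
      using a x by (simp add: tensor_gen_def lin_map_smult[OF alg_hom_lin[OF proj]] b)
  qed
qed

text \<open>A product in \<open>B\<close> is linear in each of its factors, so evaluating words through a linear map
  respects the multilinearity relations.\<close>

lemma tensor_algebra_lift:
  assumes B: "k_algebra R B" and f: "f \<in> lin_map R M B"
  obtains \<tau> where "\<tau> \<in> alg_hom R (tensor_algebra R M) B"
    "\<And>x. x \<in> carrier M \<Longrightarrow> \<tau> (tensor_gen R M x) = f x"
proof -
  interpret F: k_algebra R FA by (rule R.free_alg_k_algebra)
  interpret B: k_algebra R B by fact
  have fc: "f \<in> carrier M \<rightarrow> carrier B" using lin_map_closed[OF f] by blast
  let ?l = "lin_ext R B (word_value B f)"
  have l: "?l \<in> alg_hom R FA B" by (rule B.free_alg_lift[OF fc])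
  have lb: "?l (basis R w) = word_value B f w" if "w \<in> lists (carrier M)" for w
    using that by (rule B.free_alg_lift_basis[OF fc])
  have wc: "word_value B f w \<in> carrier B" if "w \<in> lists (carrier M)" for w
    using that by (rule B.word_value_closed[OF fc])
  have wa: "word_value B f (u @ [x] @ v) = word_value B f u \<otimes>\<^bsub>B\<^esub> (f x \<otimes>\<^bsub>B\<^esub> word_value B f v)"
    if "u \<in> lists (carrier M)" "v \<in> lists (carrier M)" "x \<in> carrier M" for u v x
    using that B.word_value_append[OF fc, of u "x # v"] by simp
  have "?l r \<in> {\<zero>\<^bsub>B\<^esub>}" if r: "r \<in> multilin_rels R M" for r
  proof (rule lin_map_multilin_rels[OF B.module_axioms alg_hom_lin[OF l] r])
    fix u v x y assume *: "u \<in> lists (carrier M)" "v \<in> lists (carrier M)" "x \<in> carrier M" "y \<in> carrier M"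
    have "word_value B f (u @ [x \<oplus>\<^bsub>M\<^esub> y] @ v)
        = word_value B f (u @ [x] @ v) \<oplus>\<^bsub>B\<^esub> word_value B f (u @ [y] @ v)"
      using * lin_map_closed[OF f] wc
      by (simp add: wa lin_map_add[OF f] B.A.l_distr B.A.r_distr del: append_Cons append_Nil)
    moreover have "word_value B f (u @ [x \<oplus>\<^bsub>M\<^esub> y] @ v) \<in> carrier B" using * by (intro wc) auto
    moreover have "?l (basis R (u @ [z] @ v)) = word_value B f (u @ [z] @ v)" if "z \<in> carrier M" for z
      using that * by (intro lb) auto
    ultimately show "?l (basis R (u @ [x \<oplus>\<^bsub>M\<^esub> y] @ v)) \<ominus>\<^bsub>B\<^esub>
        (?l (basis R (u @ [x] @ v)) \<oplus>\<^bsub>B\<^esub> ?l (basis R (u @ [y] @ v))) \<in> {\<zero>\<^bsub>B\<^esub>}"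
      using * by (simp add: a_minus_def B.r_neg del: append_Cons append_Nil)
  next
    fix a u v x assume *: "a \<in> carrier R" "u \<in> lists (carrier M)" "v \<in> lists (carrier M)" "x \<in> carrier M"
    have "word_value B f (u @ [a \<odot>\<^bsub>M\<^esub> x] @ v) = a \<odot>\<^bsub>B\<^esub> word_value B f (u @ [x] @ v)"
      using * lin_map_closed[OF f] wc
      by (simp add: wa lin_map_smult[OF f] B.smult_mult_left B.smult_mult_right del: append_Cons append_Nil)
    moreover have "word_value B f (u @ [a \<odot>\<^bsub>M\<^esub> x] @ v) \<in> carrier B" using * by (intro wc) auto
    moreover have "?l (basis R (u @ [z] @ v)) = word_value B f (u @ [z] @ v)" if "z \<in> carrier M" for z
      using that * by (intro lb) auto
    ultimately show "?l (basis R (u @ [a \<odot>\<^bsub>M\<^esub> x] @ v)) \<ominus>\<^bsub>B\<^esub> a \<odot>\<^bsub>B\<^esub> ?l (basis R (u @ [x] @ v))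
        \<in> {\<zero>\<^bsub>B\<^esub>}"
      using * by (simp add: a_minus_def B.r_neg del: append_Cons append_Nil)
  qed
  hence "?l r = \<zero>\<^bsub>B\<^esub>" if "r \<in> multilin_sub R M" for r
    using that lin_map_span_subset[OF F.module_axioms B.module_axioms alg_hom_lin[OF l]
        multilin_rels_closed B.submodule_zero]
    unfolding multilin_sub_def by blast
  then obtain \<tau> where \<tau>: "\<tau> \<in> alg_hom R (tensor_algebra R M) B"
      "\<And>p. p \<in> carrier FA \<Longrightarrow> \<tau> (multilin_sub R M +>\<^bsub>FA\<^esub> p) = ?l p"
    using F.quot_by_factor[OF multilin_sub_ideal B l] unfolding tensor_algebra_def by metis
  have "\<tau> (tensor_gen R M x) = f x" if "x \<in> carrier M" for x
    using that lin_map_closed[OF f] by (simp add: tensor_gen_def \<tau>(2) R.free_alg_basis_closed lb)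
  with \<tau>(1) show thesis by (rule that)
qed

lemma tensor_algebra_hom_eqI:
  assumes B: "k_algebra R B"
    and f: "f \<in> alg_hom R (tensor_algebra R M) B" and g: "g \<in> alg_hom R (tensor_algebra R M) B"
    and eq: "\<And>x. x \<in> carrier M \<Longrightarrow> f (tensor_gen R M x) = g (tensor_gen R M x)"
    and t: "t \<in> carrier (tensor_algebra R M)"
  shows "f t = g t"
proof -
  interpret F: k_algebra R FA by (rule R.free_alg_k_algebra)
  note proj = F.quot_by_proj[OF multilin_sub_ideal, folded tensor_algebra_def]
  obtain p where "p \<in> carrier FA" "t = multilin_sub R M +>\<^bsub>FA\<^esub> p"
    using t by (auto simp: tensor_algebra_def quot_by_simps a_rcosets_iff)
  thus ?thesis
    using k_algebra.free_alg_hom_eqI[OF B alg_hom_comp[OF proj f] alg_hom_comp[OF proj g]] eq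
    by (simp add: tensor_gen_def)
qed

end

section \<open>Sweedler sums\<close>

context hopf_algebra
begin

text \<open>The comultiplication takes values in the cosets that make up the tensor square; these are nonempty
  sets of finite formal combinations of pairs, so the choice in \<^const>\<open>tensor_lift\<close> picks one.\<close>

lemma comult_representative:
  assumes "h \<in> carrier H"
  shows "(SOME p. p \<in> comult H h) \<in> carrier (free_module k (carrier H \<times> carrier H))"
proof -
  let ?F = "free_module k (carrier H \<times> carrier H)" and ?N = "tensor_sub k H H"
  interpret F: module k ?F by (rule R.module_free_module)
  have b: "basis k (x, y) \<in> carrier ?F" if "x \<in> carrier H" "y \<in> carrier H" for x y
    using that by (intro R.basis_closed) simp
  have "bilin_rels k H H \<subseteq> carrier ?F"
    unfolding bilin_rels_def Let_def by (auto intro!: F.M.minus_closed F.M.a_closed F.smult_closed b)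
  hence sub: "submodule ?N k ?F"
    unfolding tensor_sub_def by (rule F.span_of_submodule)
  have "comult H h \<in> carrier (tensor_alg k H H)"
    using alg_hom_closed[OF comult_hom assms] .
  hence "comult H h \<in> carrier (tensor_mod k H H)"
    by (simp add: tensor_alg_def Let_def)
  then obtain p where p: "p \<in> carrier ?F" "comult H h = ?N +>\<^bsub>?F\<^esub> p"
    unfolding tensor_mod_def quot_by_simps a_rcosets_iff by blast
  have "comult H h \<subseteq> carrier ?F" "comult H h \<noteq> {}"
    using F.submoduleE(1,2)[OF sub] p by (auto simp: a_r_coset_def' subset_iff)
  thus ?thesis using some_in_eq by blast
qed

text \<open>Sweedler sums over \<open>h\<close> in different modules are formed with the same representative of the
  comultiplication of \<open>h\<close>, so linear maps commute with them term by term.\<close>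

lemma sweedler_natural:
  assumes M: "module k M" and N: "module k N" and q: "q \<in> lin_map k M N" and h: "h \<in> carrier H"
    and f: "\<And>x y. \<lbrakk>x \<in> carrier H; y \<in> carrier H\<rbrakk> \<Longrightarrow> f x y \<in> carrier M"
    and g: "\<And>x y. \<lbrakk>x \<in> carrier H; y \<in> carrier H\<rbrakk> \<Longrightarrow> q (f x y) = g x y"
  shows "q (sweedler k H M f h) = sweedler k H N g h"
  unfolding sweedler_def tensor_lift_def
  by (rule lin_map_lin_ext[OF M N q comult_representative[OF h]]) (auto simp: f g)

lemma sweedler_closed:
  assumes M: "module k M" and h: "h \<in> carrier H"
    and f: "\<And>x y. \<lbrakk>x \<in> carrier H; y \<in> carrier H\<rbrakk> \<Longrightarrow> f x y \<in> carrier M"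
  shows "sweedler k H M f h \<in> carrier M"
proof -
  interpret M: module k M by fact
  have "lin_ext k M (\<lambda>(x, y). f x y) \<in> lin_map k (free_module k (carrier H \<times> carrier H)) M"
    by (rule M.lin_ext_lin_map) (use f in auto)
  thus ?thesis
    unfolding sweedler_def tensor_lift_def using comult_representative[OF h] by (rule lin_map_closed)
qed

end

section \<open>The partial Hopf algebra\<close>

text \<open>The two sides of each of the five axioms of a partial representation.  Keeping the sides as pairs
  lets one set serve three purposes: a partial representation is a linear map for which the sides
  agree, their differences in the tensor algebra generate the ideal that defines \<open>H\<^sub>p\<^sub>a\<^sub>r\<close>, and
  algebra morphisms act on the pairs.\<close>

definition par_rep_eqs ::
  "('r, 'm) ring_scheme \<Rightarrow> ('r, 'h, 'u) hopf_scheme \<Rightarrow> ('r, 'b, 'v) module_scheme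
    \<Rightarrow> ('h \<Rightarrow> 'b) \<Rightarrow> ('b \<times> 'b) set"
  where "par_rep_eqs k H B \<pi> =
    (let S = antipode H; sw = sweedler k H B in
      {(\<pi> \<one>\<^bsub>H\<^esub>, \<one>\<^bsub>B\<^esub>)} \<union>
      {(sw (\<lambda>l1 l2. \<pi> h \<otimes>\<^bsub>B\<^esub> \<pi> l1 \<otimes>\<^bsub>B\<^esub> \<pi> (S l2)) l,
        sw (\<lambda>l1 l2. \<pi> (h \<otimes>\<^bsub>H\<^esub> l1) \<otimes>\<^bsub>B\<^esub> \<pi> (S l2)) l) | h l.
        h \<in> carrier H \<and> l \<in> carrier H} \<union>
      {(sw (\<lambda>h1 h2. \<pi> h1 \<otimes>\<^bsub>B\<^esub> \<pi> (S h2) \<otimes>\<^bsub>B\<^esub> \<pi> l) h,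
        sw (\<lambda>h1 h2. \<pi> h1 \<otimes>\<^bsub>B\<^esub> \<pi> (S h2 \<otimes>\<^bsub>H\<^esub> l)) h) | h l.
        h \<in> carrier H \<and> l \<in> carrier H} \<union>
      {(sw (\<lambda>l1 l2. \<pi> h \<otimes>\<^bsub>B\<^esub> \<pi> (S l1) \<otimes>\<^bsub>B\<^esub> \<pi> l2) l,
        sw (\<lambda>l1 l2. \<pi> (h \<otimes>\<^bsub>H\<^esub> S l1) \<otimes>\<^bsub>B\<^esub> \<pi> l2) l) | h l.
        h \<in> carrier H \<and> l \<in> carrier H} \<union>
      {(sw (\<lambda>h1 h2. \<pi> (S h1) \<otimes>\<^bsub>B\<^esub> \<pi> h2 \<otimes>\<^bsub>B\<^esub> \<pi> l) h,
        sw (\<lambda>h1 h2. \<pi> (S h1) \<otimes>\<^bsub>B\<^esub> \<pi> (h2 \<otimes>\<^bsub>H\<^esub> l)) h) | h l.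
        h \<in> carrier H \<and> l \<in> carrier H})"

text \<open>Three rules for the families over two elements of \<open>H\<close> in which the axioms and relations are
  written; they let a proof treat all families at once.\<close>

lemma ball_setcompr2:
  "(\<forall>z\<in>{g x y | x y. x \<in> A \<and> y \<in> B}. Q z) \<longleftrightarrow> (\<forall>x\<in>A. \<forall>y\<in>B. Q (g x y))"
  by blast

lemma image_setcompr2: "f ` {g x y | x y. P x y} = {f (g x y) | x y. P x y}"
  by blast

lemma setcompr2_cong:
  "(\<And>x y. \<lbrakk>x \<in> A; y \<in> B\<rbrakk> \<Longrightarrow> f x y = g x y)
    \<Longrightarrow> {f x y | x y. x \<in> A \<and> y \<in> B} = {g x y | x y. x \<in> A \<and> y \<in> B}"
  by (rule Collect_cong) metis

lemma par_rep_iff: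
  "par_rep k H B \<pi> \<longleftrightarrow>
    \<pi> \<in> lin_map k H B \<and> \<pi> \<in> extensional (carrier H) \<and> (\<forall>(x, y) \<in> par_rep_eqs k H B \<pi>. x = y)"
  unfolding par_rep_def par_rep_eqs_def Let_def ball_Un ball_setcompr2 by simp

lemma Hpar_rels_eq:
  "Hpar_rels k H = (\<lambda>(x, y). x \<ominus>\<^bsub>tensor_algebra k H\<^esub> y) `
    par_rep_eqs k H (tensor_algebra k H) (tensor_gen k H)"
  unfolding Hpar_rels_def par_rep_eqs_def Let_def image_Un image_setcompr2 image_insert image_empty prod.case
  by (rule refl)

context hopf_algebra
begin

abbreviation (input) "T \<equiv> tensor_algebra k H"

lemma antipode_closed: "h \<in> carrier H \<Longrightarrow> antipode H h \<in> carrier H"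
  by (rule lin_map_closed[OF antipode_lin])

text \<open>Each side is built from values of \<open>\<pi>\<close> by products, Sweedler sums and the unit, and an algebra
  morphism commutes with all three.\<close>

lemma par_rep_eqs_natural:
  assumes A: "k_algebra k A" and B: "k_algebra k B" and q: "q \<in> alg_hom k A B"
    and p: "\<And>h. h \<in> carrier H \<Longrightarrow> \<pi> h \<in> carrier A"
    and r: "\<And>h. h \<in> carrier H \<Longrightarrow> q (\<pi> h) = \<rho> h"
  shows "par_rep_eqs k H B \<rho> = map_prod q q ` par_rep_eqs k H A \<pi>"
proof -
  interpret A: k_algebra k A by fact
  interpret B: k_algebra k B by fact
  have nat: "q (sweedler k H A f h) = sweedler k H B g h"
    if "h \<in> carrier H" "\<And>x y. \<lbrakk>x \<in> carrier H; y \<in> carrier H\<rbrakk> \<Longrightarrow> f x y \<in> carrier A \<and> q (f x y) = g x y" for f g h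
    using that by (intro sweedler_natural[OF A.module_axioms B.module_axioms alg_hom_lin[OF q]]) auto
  note s = antipode_closed p r alg_hom_mult[OF q]
  show ?thesis
    unfolding par_rep_eqs_def Let_def image_Un image_setcompr2 image_insert image_empty map_prod_simp
    by (intro arg_cong2[where f = "(\<union>)"] setcompr2_cong arg_cong2[where f = Pair] nat[symmetric])
       (simp_all add: s alg_hom_one[OF q])
qed

lemma par_rep_eqs_closed:
  assumes A: "k_algebra k A" and p: "\<And>h. h \<in> carrier H \<Longrightarrow> \<pi> h \<in> carrier A"
  shows "par_rep_eqs k H A \<pi> \<subseteq> carrier A \<times> carrier A"
proof -
  interpret A: k_algebra k A by fact
  note sw = sweedler_closed[OF A.module_axioms]
  show ?thesis
    unfolding par_rep_eqs_def Let_def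
    by (auto intro!: sw A.A.m_closed p antipode_closed)
qed

lemma T_k_algebra: "k_algebra k T"
  by (rule tensor_algebra_k_algebra)

lemma T_gen_closed: "h \<in> carrier H \<Longrightarrow> tensor_gen k H h \<in> carrier T"
  by (rule lin_map_closed[OF tensor_gen_lin])

lemma Hpar_rels_closed: "Hpar_rels k H \<subseteq> carrier T"
proof -
  interpret T: k_algebra k T by (rule T_k_algebra)
  show ?thesis
    unfolding Hpar_rels_eq
    using subsetD[OF par_rep_eqs_closed[of T "tensor_gen k H", OF T_k_algebra T_gen_closed]] by auto
qed

lemma Hpar_ideal: "ideal (Hpar_ideal k H) T"
  unfolding Hpar_ideal_def
  by (rule ring.genideal_ideal[OF k_algebra.axioms(2)[OF T_k_algebra] Hpar_rels_closed])

lemma Hpar_k_algebra: "k_algebra k (Hpar k H)"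
  unfolding Hpar_def by (rule k_algebra.quot_by_k_algebra[OF T_k_algebra Hpar_ideal])

lemma Hpar_proj: "(\<lambda>t. Hpar_ideal k H +>\<^bsub>T\<^esub> t) \<in> alg_hom k T (Hpar k H)"
  unfolding Hpar_def by (rule k_algebra.quot_by_proj[OF T_k_algebra Hpar_ideal])

lemma Hpar_class_eq: "h \<in> carrier H \<Longrightarrow> Hpar_class k H h = Hpar_ideal k H +>\<^bsub>T\<^esub> tensor_gen k H h"
  by (simp add: Hpar_class_def)

text \<open>The link between the ideal and the axioms: the morphism of tensor algebras extending \<open>\<rho>\<close> carries
  the pairs of universal sides to the pairs of sides for \<open>\<rho>\<close>, and so kills their differences exactly
  when the axioms hold for \<open>\<rho>\<close>.\<close>

lemma kills_rels_iff:
  assumes B: "k_algebra k B" and \<tau>: "\<tau> \<in> alg_hom k T B"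
    and r: "\<And>h. h \<in> carrier H \<Longrightarrow> \<tau> (tensor_gen k H h) = \<rho> h"
  shows "(\<forall>t\<in>Hpar_rels k H. \<tau> t = \<zero>\<^bsub>B\<^esub>) \<longleftrightarrow> (\<forall>(x, y) \<in> par_rep_eqs k H B \<rho>. x = y)"
proof -
  interpret B: k_algebra k B by fact
  interpret T: k_algebra k T by (rule T_k_algebra)
  let ?E = "par_rep_eqs k H T (tensor_gen k H)"
  have E: "?E \<subseteq> carrier T \<times> carrier T" by (rule par_rep_eqs_closed[OF T_k_algebra T_gen_closed])
  have "\<tau> (x \<ominus>\<^bsub>T\<^esub> y) = \<zero>\<^bsub>B\<^esub> \<longleftrightarrow> \<tau> x = \<tau> y" if "(x, y) \<in> ?E" for x y
  proof -
    have xy: "x \<in> carrier T" "y \<in> carrier T" using that E by auto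
    hence "\<tau> (x \<ominus>\<^bsub>T\<^esub> y) = \<tau> x \<ominus>\<^bsub>B\<^esub> \<tau> y"
      by (rule lin_map_minus[OF T.module_axioms B.module_axioms alg_hom_lin[OF \<tau>]])
    moreover have "\<tau> x = (\<tau> x \<ominus>\<^bsub>B\<^esub> \<tau> y) \<oplus>\<^bsub>B\<^esub> \<tau> y" "\<tau> y \<ominus>\<^bsub>B\<^esub> \<tau> y = \<zero>\<^bsub>B\<^esub>"
      using xy alg_hom_closed[OF \<tau>] by (simp_all add: a_minus_def B.a_assoc B.l_neg B.r_neg)
    ultimately show ?thesis using xy alg_hom_closed[OF \<tau>] by (metis B.l_zero)
  qed
  moreover have "par_rep_eqs k H B \<rho> = map_prod \<tau> \<tau> ` ?E"
    by (rule par_rep_eqs_natural[OF T_k_algebra B \<tau> T_gen_closed r])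
  ultimately show ?thesis unfolding Hpar_rels_eq by fastforce
qed

lemma Hpar_class_par_rep: "par_rep k H (Hpar k H) (Hpar_class k H)"
proof -
  interpret T: k_algebra k T by (rule T_k_algebra)
  interpret P: k_algebra k "Hpar k H" by (rule Hpar_k_algebra)
  let ?p = "\<lambda>t. Hpar_ideal k H +>\<^bsub>T\<^esub> t"
  have "?p t = \<zero>\<^bsub>Hpar k H\<^esub>" if "t \<in> Hpar_rels k H" for t
    unfolding Hpar_def using T.A.genideal_self[OF Hpar_rels_closed] that
    by (intro T.quot_by_proj_eq_zero[OF Hpar_ideal]) (auto simp: Hpar_ideal_def)
  hence "\<forall>(x, y) \<in> par_rep_eqs k H (Hpar k H) (Hpar_class k H). x = y"
    using kills_rels_iff[OF Hpar_k_algebra Hpar_proj Hpar_class_eq[symmetric]] by simp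
  moreover have "Hpar_class k H \<in> lin_map k H (Hpar k H)"
    using lin_map_comp[OF tensor_gen_lin alg_hom_lin[OF Hpar_proj]]
    by (auto simp: lin_map_def Hpar_class_def)
  moreover have "Hpar_class k H \<in> extensional (carrier H)" by (simp add: Hpar_class_def)
  ultimately show ?thesis by (simp add: par_rep_iff)
qed

lemma par_rep_comp:
  assumes A: "k_algebra k A" and B: "k_algebra k B" and \<pi>: "par_rep k H A \<pi>" and q: "q \<in> alg_hom k A B"
  shows "par_rep k H B (compose (carrier H) q \<pi>)"
proof -
  have l: "\<pi> \<in> lin_map k H A" using \<pi> by (simp add: par_rep_iff)
  have "par_rep_eqs k H B (compose (carrier H) q \<pi>) = map_prod q q ` par_rep_eqs k H A \<pi>"
    by (rule par_rep_eqs_natural[OF A B q]) (auto simp: compose_def lin_map_closed[OF l])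
  moreover have "compose (carrier H) q \<pi> \<in> lin_map k H B"
    using lin_map_comp[OF l alg_hom_lin[OF q]] by (auto simp: lin_map_def compose_def)
  ultimately show ?thesis using \<pi> by (fastforce simp: par_rep_iff compose_def)
qed

lemma Hpar_lift_exists:
  assumes B: "k_algebra k B" and \<pi>: "par_rep k H B \<pi>"
  shows "\<exists>f. f \<in> alg_mor k (Hpar k H) B \<and> \<pi> = compose (carrier H) f (Hpar_class k H)"
proof -
  interpret T: k_algebra k T by (rule T_k_algebra)
  interpret B: k_algebra k B by fact
  have l: "\<pi> \<in> lin_map k H B" and ext: "\<pi> \<in> extensional (carrier H)" using \<pi> by (simp_all add: par_rep_iff)
  obtain \<tau> where \<tau>: "\<tau> \<in> alg_hom k T B" "\<And>h. h \<in> carrier H \<Longrightarrow> \<tau> (tensor_gen k H h) = \<pi> h"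
    using tensor_algebra_lift[OF B l] by blast
  have kills: "\<forall>t\<in>Hpar_rels k H. \<tau> t = \<zero>\<^bsub>B\<^esub>"
    using kills_rels_iff[OF B \<tau>] \<pi> by (simp add: par_rep_iff)
  interpret \<tau>: ring_hom_ring T B \<tau>
    using \<tau>(1) by (intro ring_hom_ringI2 T.A.ring_axioms B.A.ring_axioms) (simp add: alg_hom_def)
  have "Hpar_rels k H \<subseteq> a_kernel T B \<tau>"
    unfolding a_kernel_def' using kills subsetD[OF Hpar_rels_closed] by (intro subsetI CollectI conjI) simp_all
  hence "Hpar_ideal k H \<subseteq> a_kernel T B \<tau>"
    unfolding Hpar_ideal_def by (rule T.A.genideal_minimal[OF \<tau>.kernel_is_ideal])
  from subsetD[OF this] have "\<tau> t = \<zero>\<^bsub>B\<^esub>" if "t \<in> Hpar_ideal k H" for t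
    using that unfolding a_kernel_def' by simp
  then obtain f where f: "f \<in> alg_hom k (Hpar k H) B"
      "\<And>t. t \<in> carrier T \<Longrightarrow> f (Hpar_ideal k H +>\<^bsub>T\<^esub> t) = \<tau> t"
    unfolding Hpar_def using T.quot_by_factor[OF Hpar_ideal B \<tau>(1)] by blast
  have cl: "Hpar_class k H h \<in> carrier (Hpar k H)" if "h \<in> carrier H" for h
    using that Hpar_class_par_rep by (auto simp: par_rep_iff intro: lin_map_closed)
  have "\<pi> = compose (carrier H) (restrict f (carrier (Hpar k H))) (Hpar_class k H)"
    using ext cl
    by (intro extensionalityI[OF ext]) (auto simp: compose_def Hpar_class_eq f(2) \<tau>(2) T_gen_closed)
  with restrict_alg_mor[OF Hpar_k_algebra f(1)] show ?thesis by blast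
qed

text \<open>The classes of elements of \<open>H\<close> generate \<open>H\<^sub>p\<^sub>a\<^sub>r\<close>, since the letters generate the free algebra.\<close>

lemma Hpar_mor_eqI:
  assumes B: "k_algebra k B" and f: "f \<in> alg_mor k (Hpar k H) B" and g: "g \<in> alg_mor k (Hpar k H) B"
    and eq: "compose (carrier H) f (Hpar_class k H) = compose (carrier H) g (Hpar_class k H)"
  shows "f = g"
proof (rule extensionalityI)
  show "f \<in> extensional (carrier (Hpar k H))" "g \<in> extensional (carrier (Hpar k H))"
    using f g by (simp_all add: alg_mor_def)
  fix X assume "X \<in> carrier (Hpar k H)"
  then obtain t where t: "t \<in> carrier T" "X = Hpar_ideal k H +>\<^bsub>T\<^esub> t"
    by (auto simp: Hpar_def quot_by_simps a_rcosets_iff)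
  have f': "f \<in> alg_hom k (Hpar k H) B" and g': "g \<in> alg_hom k (Hpar k H) B"
    using f g by (simp_all add: alg_mor_def)
  have "f (Hpar_ideal k H +>\<^bsub>T\<^esub> tensor_gen k H h) = g (Hpar_ideal k H +>\<^bsub>T\<^esub> tensor_gen k H h)"
    if "h \<in> carrier H" for h
    using that fun_cong[OF eq, of h] by (simp add: compose_def Hpar_class_eq)
  with tensor_algebra_hom_eqI[OF B alg_hom_comp[OF Hpar_proj f'] alg_hom_comp[OF Hpar_proj g']] t
  show "f X = g X" by simp
qed

lemma Hpar_lift:
  assumes "k_algebra k B" "par_rep k H B \<pi>"
  shows "\<exists>!f. f \<in> alg_mor k (Hpar k H) B \<and> \<pi> = compose (carrier H) f (Hpar_class k H)"
  proof (rule ex_ex1I[OF Hpar_lift_exists[OF assms]])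
qed (rule Hpar_mor_eqI[OF assms(1)], auto)

lemma par_rep_hat:
  assumes "k_algebra k B" "par_rep k H B \<pi>"
  shows "par_rep_hat k H B \<pi> \<in> alg_mor k (Hpar k H) B"
    and "compose (carrier H) (par_rep_hat k H B \<pi>) (Hpar_class k H) = \<pi>"
  using theI'[OF Hpar_lift[OF assms]] by (simp_all add: par_rep_hat_def)

text \<open>Composing \<open>\<phi>\<close> with the universal partial representation gives a partial representation, and by
  uniqueness of lifts \<open>\<phi>\<close> is its lift.\<close>

lemma par_rep_hat_eq_iff:
  assumes B: "k_algebra k B" and \<phi>: "\<phi> \<in> alg_mor k (Hpar k H) B"
  shows "par_rep k H B \<pi> \<and> \<phi> = par_rep_hat k H B \<pi> \<longleftrightarrow> \<pi> = compose (carrier H) \<phi> (Hpar_class k H)"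
proof -
  have "par_rep k H B (compose (carrier H) \<phi> (Hpar_class k H))"
    using \<phi> by (intro par_rep_comp[OF Hpar_k_algebra B Hpar_class_par_rep]) (simp add: alg_mor_def)
  thus ?thesis using par_rep_hat[OF B] Hpar_mor_eqI[OF B \<phi>] by metis
qed

lemma par_rep_of_eq:
  assumes "k_algebra k B" "\<phi> \<in> alg_mor k (Hpar k H) B"
  shows "par_rep_of k H B \<phi> = compose (carrier H) \<phi> (Hpar_class k H)"
  unfolding par_rep_of_def par_rep_hat_eq_iff[OF assms] by simp

end

section \<open>The isomorphism of categories\<close>

lemma alg_mor_id: "k_algebra k B \<Longrightarrow> (\<lambda>x\<in>carrier B. x) \<in> alg_mor k B B"
  by (intro restrict_alg_mor alg_homI lin_mapI) auto

lemma alg_mor_funcset: "f \<in> alg_mor k A B \<Longrightarrow> f \<in> carrier A \<rightarrow> carrier B"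
  and alg_mor_ext: "f \<in> alg_mor k A B \<Longrightarrow> f \<in> extensional (carrier A)"
  by (auto simp: alg_mor_def alg_hom_closed)

lemma compose_id_right: "f \<in> extensional A \<Longrightarrow> compose A f (\<lambda>x\<in>A. x) = f"
  by (auto simp: compose_def extensional_def fun_eq_iff)

lemma compose_id_left: "\<lbrakk>f \<in> A \<rightarrow> B; f \<in> extensional A\<rbrakk> \<Longrightarrow> compose A (\<lambda>x\<in>B. x) f = f"
  by (auto simp: compose_def extensional_def fun_eq_iff)

lemma compose_compose: "f \<in> A \<rightarrow> B \<Longrightarrow> compose A (compose B h g) f = compose A h (compose A g f)"
  by (auto simp: compose_def fun_eq_iff)

lemma ParRep_is_category:
  fixes k :: "('r, 'm) ring_scheme" and H :: "('r, 'h) hopf"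
  shows "is_category (ParRep k H :: (('r, 'b) module \<times> ('h \<Rightarrow> 'b), 'b \<Rightarrow> 'b) cat)"
proof -
  have [simp]: "f \<in> carrier H \<rightarrow> carrier B" "f \<in> extensional (carrier H)"
    if "par_rep k H B f" for f and B :: "('r, 'b) module"
    using that by (auto simp: par_rep_iff lin_map_closed)
  show ?thesis
    unfolding is_category_def ParRep_def
    by (auto simp: alg_mor_id compose_id_left compose_id_right compose_compose[symmetric] compose_alg_mor
        alg_mor_funcset alg_mor_ext compose_compose)
qed

lemma Coslice_is_category:
  fixes k :: "('r, 'm) ring_scheme" and A :: "('r, 'a, 'u) module_scheme"
  assumes "k_algebra k A"
  shows "is_category (Coslice k A :: (('r, 'b) module \<times> ('a \<Rightarrow> 'b), 'b \<Rightarrow> 'b) cat)"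
  unfolding is_category_def Coslice_def
  using assms
  by (auto simp: alg_mor_id compose_id_left compose_id_right compose_alg_mor
      alg_mor_funcset alg_mor_ext compose_compose)

theorem theorem4p2:
  fixes k :: "('r, 'm) ring_scheme" and H :: "('r, 'h) hopf"
  assumes "hopf_algebra k H"
  shows
    "(\<forall>(B :: ('r, 'b) module) \<pi>. k_algebra k B \<and> par_rep k H B \<pi> \<longrightarrow>
        (\<exists>!f. f \<in> alg_mor k (Hpar k H) B \<and> \<pi> = compose (carrier H) f (Hpar_class k H))) \<and>
     (\<forall>(B :: ('r, 'b) module) \<phi>. k_algebra k B \<and> \<phi> \<in> alg_mor k (Hpar k H) B \<longrightarrow>
        (\<exists>!\<pi>. par_rep k H B \<pi> \<and> \<phi> = par_rep_hat k H B \<pi>)) \<and>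
     isomorphism_of_categories
       (ParRep k H :: (('r, 'b) module \<times> ('h \<Rightarrow> 'b), 'b \<Rightarrow> 'b) cat)
       (Coslice k (Hpar k H))
       (L_functor k H) (R_functor k H)"
proof -
  interpret hopf_algebra k H by (fact assms)
  let ?P = "ParRep k H :: (('r, 'b) module \<times> ('h \<Rightarrow> 'b), 'b \<Rightarrow> 'b) cat"
    and ?C = "Coslice k (Hpar k H) :: (('r, 'b) module \<times> (('h list \<Rightarrow> 'r) set set \<Rightarrow> 'b), 'b \<Rightarrow> 'b) cat"
  have of_inverse: "par_rep k H B (par_rep_of k H B \<phi>)" "par_rep_hat k H B (par_rep_of k H B \<phi>) = \<phi>"
    if "k_algebra k B" "\<phi> \<in> alg_mor k (Hpar k H) B" for \<phi> and B :: "('r, 'b) module"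
    using par_rep_hat_eq_iff[OF that, of "par_rep_of k H B \<phi>"] par_rep_of_eq[OF that] by auto
  have of_hat: "par_rep_of k H B (par_rep_hat k H B \<pi>) = \<pi>"
    if "k_algebra k B" "par_rep k H B \<pi>" for \<pi> and B :: "('r, 'b) module"
    using par_rep_hat[OF that] par_rep_of_eq[OF that(1)] by simp
  \<comment> \<open>Lifting commutes with composition by \<open>f\<close>, so \<open>f\<close> satisfies the condition on morphisms of one
    category exactly when it satisfies that of the other.\<close>
  have hat_mor: "compose (carrier (Hpar k H)) f (par_rep_hat k H B \<pi>)
      = par_rep_hat k H B' (compose (carrier H) f \<pi>)"
    if B: "k_algebra k B" and B': "k_algebra k B'" and \<pi>: "par_rep k H B \<pi>"
      and f: "f \<in> alg_mor k B B'"
    for B B' :: "('r, 'b) module" and f \<pi>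
  proof -
    note \<pi>' = par_rep_comp[OF B B' \<pi>, of f]
    have "compose (carrier H) (compose (carrier (Hpar k H)) f (par_rep_hat k H B \<pi>)) (Hpar_class k H)
        = compose (carrier H) f \<pi>"
      using Hpar_class_par_rep par_rep_hat(2)[OF B \<pi>]
      by (subst compose_compose[of _ _ "carrier (Hpar k H)"]) (auto simp: par_rep_iff intro: lin_map_closed)
    thus ?thesis
      using f par_rep_hat[OF B' \<pi>'] compose_alg_mor[OF Hpar_k_algebra par_rep_hat(1)[OF B \<pi>] f]
      by (intro Hpar_mor_eqI[OF B']) (auto simp: alg_mor_def)
  qed
  have of_mor: "compose (carrier H) f (par_rep_of k H B \<phi>)
      = par_rep_of k H B' (compose (carrier (Hpar k H)) f \<phi>)"
    if B: "k_algebra k B" and B': "k_algebra k B'" and \<phi>: "\<phi> \<in> alg_mor k (Hpar k H) B"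
      and f: "f \<in> alg_mor k B B'"
    for B B' :: "('r, 'b) module" and f \<phi>
    using hat_mor[OF B B' of_inverse(1)[OF B \<phi>] f] of_inverse(2)[OF B \<phi>] of_hat[OF B']
      par_rep_comp[OF B B' of_inverse(1)[OF B \<phi>], of f] f
    by (simp add: alg_mor_def)
  have cats: "is_category ?P" "is_category ?C"
    by (rule ParRep_is_category, rule Coslice_is_category[OF Hpar_k_algebra])
  have L: "is_functor ?P ?C (L_functor k H)"
    unfolding is_functor_def using cats
    by (auto simp: ParRep_def Coslice_def L_functor_def par_rep_hat(1) hat_mor)
  have R: "is_functor ?C ?P (R_functor k H)"
    unfolding is_functor_def using cats
    by (auto simp: ParRep_def Coslice_def R_functor_def of_inverse(1) of_mor)
  have inv: "left_inverse_functor ?P (L_functor k H) (R_functor k H)"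
    "left_inverse_functor ?C (R_functor k H) (L_functor k H)"
    by (auto simp: left_inverse_functor_def ParRep_def Coslice_def L_functor_def R_functor_def of_inverse(2) of_hat)
  have uniq: "\<exists>!\<pi>. par_rep k H B \<pi> \<and> \<phi> = par_rep_hat k H B \<pi>"
    if "k_algebra k B" "\<phi> \<in> alg_mor k (Hpar k H) B" for B :: "('r, 'b) module" and \<phi>
    unfolding par_rep_hat_eq_iff[OF that] by simp
  show ?thesis
    unfolding isomorphism_of_categories_def
    by (intro conjI allI impI L R inv) (elim conjE, rule Hpar_lift uniq; assumption)+
qed

end
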